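(* Let $d\ge 1$ be an integer, let $1 \le q < \infty$, and let $D \subseteq \mathbb{Z}^d$ be sparse. Write $D_N = D \cap R_N$, and suppose that the sequence of sets $\{D_N\}$ is universally pointwise $L^p$-good for every $p > q$. Then there is a set $S \subseteq \mathbb{Z}^d$ such that, with $S_N = S \cap R_N$, the sequence $\{S_N\}$ is a perturbation of $\{D_N\}$, the sequence $\{S_N\}$ is universally pointwise $L^p$-good for every $p > q$, and $\{S_N\}$ is universally $\infty$-sweeping out for $L^q$.
   Context: $\#A$ denotes the cardinality of a set $A$. For a natural number $N$, $R_N = \{-N,\dots,N\}^d$ is the cube in $\mathbb{Z}^d$ of side length $2N+1$ centered at the origin, and $B_N$ is the ball of radius $N$ in $\mathbb{Z}^d$ centered at the origin (Euclidean norm). Sparse: $D\subseteq\mathbb{Z}^d$ is sparse if $\lim_{N\to\infty} \#(D\cap B_N)/\#B_N = 0$. Actions: a free (aperiodic) $\mathbb{Z}^d$-action $(X,\mathcal{B},m,T)$ is a measure-preserving action $T=(T_g)_{g\in\mathbb{Z}^d}$ of $\mathbb{Z}^d$ on a measure space $(X,\mathcal{B},m)$ of finite measure such that for every $g\ne 0$ the set $\{x: T_g x = x\}$ has measure $0$. $L^p$ means $L^p(X,\mathcal{B},m)$. Good: a sequence $\{S_n\}$ of finite sets in $\mathbb{Z}^d$ is universally pointwise $L^p$-good ($p\ge1$) if for every free $\mathbb{Z}^d$-action and every $f\in L^p$, the averages $\frac{1}{\#S_n}\sum_{g\in S_n} f(T_g x)$ converge as $n\to\infty$ for a.e. $x\in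 X$. Sweeping out: $\{S_n\}$ is universally $\infty$-sweeping out for $L^p$ ($p\ge 1$) if for every free $\mathbb{Z}^d$-action there is $f\in L^p$ with $\sup_n \frac{1}{\#S_n}\sum_{g\in S_n} f(T_g x)=\infty$ for a.e. $x\in X$. Perturbation: $\{S_n\}$ is a perturbation of $\{D_n\}$ if $\lim_{n\to\infty} \#(S_n\,\triangle\, D_n)/\#D_n = 0$, where $\triangle$ is symmetric difference. Averages and quotients are considered only for indices where the set in the denominator is nonempty.
   Formalization: The set D is additionally assumed infinite (the claim fails for finite nonempty D), and free actions are taken on finite measure spaces in which countably many measurable sets separate points (otherwise it is false); points are real numbers, which covers every such space up to isomorphism. *)

theory Defs
  imports "HOL-Analysis.Analysis"
begin

text \<open>The lattice \<open>\<int>\<^sup>d\<close> is the type \<^typ>\<open>int ^ 'd\<close>, so \<open>d = CARD('d) \<ge> 1\<close>.\<close>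

definition cube :: "nat \<Rightarrow> (int ^ 'd) set" where
  "cube N = {z. \<forall>i. \<bar>z $ i\<bar> \<le> int N}"

definition lattice_ball :: "nat \<Rightarrow> (int ^ 'd) set" where
  "lattice_ball N = {z. norm ((\<chi> i. real_of_int (z $ i)) :: real ^ 'd) \<le> real N}"

definition sparse_set :: "(int ^ 'd) set \<Rightarrow> bool" where
  "sparse_set D \<longleftrightarrow>
     (\<lambda>N. real (card (D \<inter> lattice_ball N)) / real (card (lattice_ball N :: (int ^ 'd) set)))
       \<longlonglongrightarrow> 0"

text \<open>
  Averages over \<open>S n\<close> and quotients by \<open>card (S n)\<close> are only considered for those \<open>n\<close> with
  \<open>S n \<noteq> {}\<close>; limits are taken along this filter, which is \<^const>\<open>sequentially\<close> as soon as
  \<open>S n\<close> is eventually nonempty.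
\<close>

definition nonempty_indices :: "(nat \<Rightarrow> 'g set) \<Rightarrow> nat filter" where
  "nonempty_indices S = inf sequentially (principal {n. S n \<noteq> {}})"

definition perturbation :: "(nat \<Rightarrow> 'g set) \<Rightarrow> (nat \<Rightarrow> 'g set) \<Rightarrow> bool" where
  "perturbation S D \<longleftrightarrow>
     (\<forall>n. finite (S n)) \<and> (\<forall>n. finite (D n)) \<and>
     ((\<lambda>n. real (card ((S n - D n) \<union> (D n - S n))) / real (card (D n))) \<longlongrightarrow> 0)
       (nonempty_indices D)"

text \<open>
  For an arbitrary \<open>\<sigma>\<close>-algebra the sets \<open>{x. T g x = x}\<close> need not be measurable, and
  fixed points say nothing about measurable functions: translation on \<open>\<int>\<^sup>d\<close> with the trivial
  \<open>\<sigma>\<close>-algebra has no fixed points, but only constant functions are measurable. As is customary,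
  the underlying space is therefore assumed to be regular; all that is asked for is that countably
  many measurable sets separate the points. This covers standard Borel spaces, their
  completions, and Lebesgue spaces in the sense of Rokhlin.
\<close>

definition countably_separated :: "'a measure \<Rightarrow> bool" where
  "countably_separated M \<longleftrightarrow>
     (\<exists>E :: nat \<Rightarrow> 'a set. range E \<subseteq> sets M \<and>
        (\<forall>x\<in>space M. \<forall>y\<in>space M. (\<forall>n. x \<in> E n \<longleftrightarrow> y \<in> E n) \<longrightarrow> x = y))"

locale free_action = finite_measure M for M :: "'a measure" +
  fixes T :: "int ^ 'd \<Rightarrow> 'a \<Rightarrow> 'a"
  assumes separated: "countably_separated M"
    and measurable_T: "T g \<in> measurable M M"
    and preserves: "distr M M (T g) = M"
    and T_zero: "x \<in> space M \<Longrightarrow> T 0 x = x"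
    and T_add: "x \<in> space M \<Longrightarrow> T (g + h) x = T g (T h x)"
    and free: "g \<noteq> 0 \<Longrightarrow> {x \<in> space M. T g x = x} \<in> null_sets M"

definition Lp :: "real \<Rightarrow> 'a measure \<Rightarrow> ('a \<Rightarrow> real) set" where
  "Lp p M = {f \<in> borel_measurable M. integrable M (\<lambda>x. \<bar>f x\<bar> powr p)}"

definition average :: "('g \<Rightarrow> 'a \<Rightarrow> 'a) \<Rightarrow> 'g set \<Rightarrow> ('a \<Rightarrow> real) \<Rightarrow> 'a \<Rightarrow> real" where
  "average T A f x = (1 / real (card A)) * (\<Sum>g\<in>A. f (T g x))"

text \<open>
  The first argument fixes the type of points of the spaces on which \<open>\<int>\<^sup>d\<close> acts. A countably
  separated space has at most continuum many points, so the instance \<^typ>\<open>real\<close> accounts for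
  all free actions: see \<open>universally_pointwise_good_transfer\<close> and
  \<open>universally_sweeping_out_transfer\<close> below.
\<close>

definition universally_pointwise_good ::
    "'a itself \<Rightarrow> real \<Rightarrow> (nat \<Rightarrow> (int ^ 'd) set) \<Rightarrow> bool" where
  "universally_pointwise_good t p S \<longleftrightarrow>
     (\<forall>n. finite (S n)) \<and>
     (\<forall>(M :: 'a measure) T. free_action M T \<longrightarrow>
        (\<forall>f\<in>Lp p M. AE x in M. \<exists>l. ((\<lambda>n. average T (S n) f x) \<longlongrightarrow> l) (nonempty_indices S)))"

definition universally_sweeping_out ::
    "'a itself \<Rightarrow> real \<Rightarrow> (nat \<Rightarrow> (int ^ 'd) set) \<Rightarrow> bool" where
  "universally_sweeping_out t p S \<longleftrightarrow>
     (\<forall>n. finite (S n)) \<and>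
     (\<forall>(M :: 'a measure) T. free_action M T \<longrightarrow>
        (\<exists>f\<in>Lp p M. AE x in M. (SUP n\<in>{n. S n \<noteq> {}}. ereal (average T (S n) f x)) = \<infinity>))"

lemma countably_separated_inj_real:
  assumes "countably_separated (M :: 'a measure)"
  obtains \<phi> :: "'a \<Rightarrow> real" where "inj_on \<phi> (space M)"
proof -
  obtain E :: "nat \<Rightarrow> 'a set"
    where E: "\<forall>x\<in>space M. \<forall>y\<in>space M. (\<forall>n. x \<in> E n \<longleftrightarrow> y \<in> E n) \<longrightarrow> x = y"
    using assms unfolding countably_separated_def by (elim exE conjE)
  obtain c :: "nat set \<Rightarrow> real" where c: "bij c"
    using nat_sets_eqpoll_reals unfolding eqpoll_def by blast
  have "inj_on (\<lambda>x. c {n. x \<in> E n}) (space M)"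
  proof (rule inj_onI)
    fix x y assume xy: "x \<in> space M" "y \<in> space M" "c {n. x \<in> E n} = c {n. y \<in> E n}"
    then have "{n. x \<in> E n} = {n. y \<in> E n}"
      using c by (simp add: bij_def inj_eq)
    then show "x = y"
      using E xy(1,2) by (simp add: set_eq_iff)
  qed
  then show thesis by (rule that)
qed

lemma measurable_the_inv_embed:
  assumes "inj_on \<phi> (space M)"
  shows "the_inv_into (space M) \<phi> \<in> measurable (embed_measure M \<phi>) M"
proof (rule measurable_embed_measure1)
  show "(\<lambda>x. the_inv_into (space M) \<phi> (\<phi> x)) \<in> measurable M M"
    by (subst measurable_cong[where g = "\<lambda>x. x"]) (simp_all add: the_inv_into_f_f[OF assms])
qed

lemma free_action_embed:
  fixes T :: "int ^ 'd \<Rightarrow> 'a \<Rightarrow> 'a"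
  assumes "free_action M T" and inj: "inj_on \<phi> (space M)"
  shows "free_action (embed_measure M \<phi>) (\<lambda>g y. \<phi> (T g (the_inv_into (space M) \<phi> y)))"
proof -
  interpret free_action M T by fact
  let ?N = "embed_measure M \<phi>"
  let ?\<psi> = "the_inv_into (space M) \<phi>"
  have \<psi>: "?\<psi> (\<phi> x) = x" if "x \<in> space M" for x
    using inj that by (rule the_inv_into_f_f)
  have [measurable]: "\<phi> \<in> measurable M ?N"
    using inj by (rule measurable_embed_measure2')
  have [measurable]: "?\<psi> \<in> measurable ?N M"
    using inj by (rule measurable_the_inv_embed)
  note [measurable] = measurable_T
  have Tsp: "T g x \<in> space M" if "x \<in> space M" for g x
    using measurable_space[OF measurable_T that] .
  have N: "distr M ?N \<phi> = ?N"
    using embed_measure_eq_distr'[OF inj] by simp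
  have meas: "(\<lambda>y. \<phi> (T g (?\<psi> y))) \<in> measurable ?N ?N" for g
    by measurable
  show ?thesis
  proof (intro free_action.intro finite_measureI free_action_axioms.intro)
    have "emeasure ?N (space ?N) = emeasure M (space M)"
      using emeasure_embed_measure_image'[OF inj sets.top] by (simp add: space_embed_measure)
    then show "emeasure ?N (space ?N) \<noteq> \<infinity>" by simp
  next
    obtain E :: "nat \<Rightarrow> 'a set" where E: "range E \<subseteq> sets M"
      "\<forall>x\<in>space M. \<forall>y\<in>space M. (\<forall>n. x \<in> E n \<longleftrightarrow> y \<in> E n) \<longrightarrow> x = y"
      using separated unfolding countably_separated_def by (elim exE conjE)
    have sub: "E n \<subseteq> space M" for n
      using E(1) by (intro sets.sets_into_space) auto
    have iff: "\<phi> x \<in> \<phi> ` E n \<longleftrightarrow> x \<in> E n" if "x \<in> space M" for x n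
      using inj_on_image_mem_iff[OF inj that sub] .
    show "countably_separated ?N"
      unfolding countably_separated_def
    proof (intro exI[of _ "\<lambda>n. \<phi> ` E n"] conjI ballI impI)
      show "range (\<lambda>n. \<phi> ` E n) \<subseteq> sets ?N"
        using E(1) by (auto intro: in_sets_embed_measure)
    next
      fix x y assume "x \<in> space ?N" "y \<in> space ?N" "\<forall>n. x \<in> \<phi> ` E n \<longleftrightarrow> y \<in> \<phi> ` E n"
      then obtain x' y' where *: "x = \<phi> x'" "y = \<phi> y'" "x' \<in> space M" "y' \<in> space M"
          "\<forall>n. \<phi> x' \<in> \<phi> ` E n \<longleftrightarrow> \<phi> y' \<in> \<phi> ` E n"
        unfolding space_embed_measure by blast
      then have "x' = y'"
        using iff by (intro E(2)[rule_format]) simp_all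
      then show "x = y"
        using * by simp
    qed
  next
    show "(\<lambda>y. \<phi> (T g (?\<psi> y))) \<in> measurable ?N ?N" for g by (rule meas)
  next
    fix g
    have "distr ?N ?N (\<lambda>y. \<phi> (T g (?\<psi> y))) = distr (distr M ?N \<phi>) ?N (\<lambda>y. \<phi> (T g (?\<psi> y)))"
      by (simp add: N)
    also have "\<dots> = distr M ?N (\<lambda>x. \<phi> (T g x))"
      by (subst distr_distr[OF meas]) (auto intro!: distr_cong simp: \<psi>)
    also have "\<dots> = distr (distr M M (T g)) ?N \<phi>"
      by (subst distr_distr) (auto simp: comp_def)
    finally show "distr ?N ?N (\<lambda>y. \<phi> (T g (?\<psi> y))) = ?N"
      by (simp add: preserves N)
  next
    show "\<phi> (T 0 (?\<psi> x)) = x" if "x \<in> space ?N" for x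
      using that by (auto simp: space_embed_measure \<psi> T_zero)
  next
    show "\<phi> (T (g + h) (?\<psi> x)) = \<phi> (T g (?\<psi> (\<phi> (T h (?\<psi> x)))))" if "x \<in> space ?N" for x g h
      using that by (auto simp: space_embed_measure \<psi> T_add Tsp)
  next
    fix g :: "int ^ 'd" assume "g \<noteq> 0"
    have eq: "{y \<in> space ?N. \<phi> (T g (?\<psi> y)) = y} = \<phi> ` {x \<in> space M. T g x = x}"
      using inj by (auto simp: space_embed_measure \<psi> Tsp inj_on_eq_iff)
    show "{y \<in> space ?N. \<phi> (T g (?\<psi> y)) = y} \<in> null_sets ?N"
      unfolding eq using free[OF \<open>g \<noteq> 0\<close>]
      by (auto simp: null_sets_def emeasure_embed_measure_image'[OF inj] in_sets_embed_measure)
  qed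
qed

lemma universally_pointwise_good_transfer:
  fixes S :: "nat \<Rightarrow> (int ^ 'd) set"
  assumes good: "universally_pointwise_good TYPE(real) p S"
  shows "universally_pointwise_good TYPE('a) p S"
  unfolding universally_pointwise_good_def
proof (intro conjI allI impI ballI)
  show "finite (S n)" for n
    using good by (simp add: universally_pointwise_good_def)
next
  fix M :: "'a measure" and T :: "int ^ 'd \<Rightarrow> 'a \<Rightarrow> 'a" and f
  assume act: "free_action M T" and f: "f \<in> Lp p M"
  interpret free_action M T by fact
  obtain \<phi> :: "'a \<Rightarrow> real" where inj: "inj_on \<phi> (space M)"
    using separated by (rule countably_separated_inj_real)
  let ?N = "embed_measure M \<phi>"
  let ?\<psi> = "the_inv_into (space M) \<phi>"
  let ?T = "\<lambda>g y. \<phi> (T g (?\<psi> y))"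
  have \<psi>: "?\<psi> (\<phi> x) = x" if "x \<in> space M" for x
    using inj that by (rule the_inv_into_f_f)
  have [measurable]: "\<phi> \<in> measurable M ?N"
    using inj by (rule measurable_embed_measure2')
  have [measurable]: "?\<psi> \<in> measurable ?N M"
    using inj by (rule measurable_the_inv_embed)
  have [measurable]: "f \<in> borel_measurable M" and int: "integrable M (\<lambda>x. \<bar>f x\<bar> powr p)"
    using f by (auto simp: Lp_def)
  have Tsp: "T g x \<in> space M" if "x \<in> space M" for g x
    using measurable_space[OF measurable_T that] .
  have "integrable (distr M ?N \<phi>) (\<lambda>y. \<bar>f (?\<psi> y)\<bar> powr p)"
    by (subst integrable_distr_eq) (auto simp: \<psi> int cong: Bochner_Integration.integrable_cong)
  then have "(\<lambda>y. f (?\<psi> y)) \<in> Lp p ?N"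
    by (simp add: Lp_def flip: embed_measure_eq_distr'[OF inj])
  then have "AE y in ?N. \<exists>l. ((\<lambda>n. average ?T (S n) (\<lambda>y. f (?\<psi> y)) y) \<longlongrightarrow> l) (nonempty_indices S)"
    using good free_action_embed[OF act inj] unfolding universally_pointwise_good_def by blast
  then have "AE x in M. \<exists>l.
      ((\<lambda>n. average ?T (S n) (\<lambda>y. f (?\<psi> y)) (\<phi> x)) \<longlongrightarrow> l) (nonempty_indices S)"
    by (simp only: AE_embed_measure'[OF inj])
  then show "AE x in M. \<exists>l. ((\<lambda>n. average T (S n) f x) \<longlongrightarrow> l) (nonempty_indices S)"
    by (rule AE_mp) (rule AE_I2, simp add: average_def \<psi> Tsp)
qed

lemma universally_sweeping_out_transfer:
  fixes S :: "nat \<Rightarrow> (int ^ 'd) set"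
  assumes sweep: "universally_sweeping_out TYPE(real) p S"
  shows "universally_sweeping_out TYPE('a) p S"
  unfolding universally_sweeping_out_def
proof (intro conjI allI impI)
  show "finite (S n)" for n
    using sweep by (simp add: universally_sweeping_out_def)
next
  fix M :: "'a measure" and T :: "int ^ 'd \<Rightarrow> 'a \<Rightarrow> 'a"
  assume act: "free_action M T"
  interpret free_action M T by fact
  obtain \<phi> :: "'a \<Rightarrow> real" where inj: "inj_on \<phi> (space M)"
    using separated by (rule countably_separated_inj_real)
  let ?N = "embed_measure M \<phi>"
  let ?\<psi> = "the_inv_into (space M) \<phi>"
  let ?T = "\<lambda>g y. \<phi> (T g (?\<psi> y))"
  have \<psi>: "?\<psi> (\<phi> x) = x" if "x \<in> space M" for x
    using inj that by (rule the_inv_into_f_f)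
  have [measurable]: "\<phi> \<in> measurable M ?N"
    using inj by (rule measurable_embed_measure2')
  have "\<exists>f\<in>Lp p ?N. AE y in ?N. (SUP n\<in>{n. S n \<noteq> {}}. ereal (average ?T (S n) f y)) = \<infinity>"
    using sweep free_action_embed[OF act inj] unfolding universally_sweeping_out_def by simp
  then obtain f where f: "f \<in> Lp p ?N"
    and AE: "AE y in ?N. (SUP n\<in>{n. S n \<noteq> {}}. ereal (average ?T (S n) f y)) = \<infinity>"
    by (rule bexE)
  have [measurable]: "f \<in> borel_measurable ?N" and int: "integrable ?N (\<lambda>y. \<bar>f y\<bar> powr p)"
    using f by (auto simp: Lp_def)
  have "integrable (distr M ?N \<phi>) (\<lambda>y. \<bar>f y\<bar> powr p)"
    using int by (simp flip: embed_measure_eq_distr'[OF inj])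
  then have "integrable M (\<lambda>x. \<bar>f (\<phi> x)\<bar> powr p)"
    by (subst (asm) integrable_distr_eq) auto
  then have Lp: "(\<lambda>x. f (\<phi> x)) \<in> Lp p M"
    by (simp add: Lp_def)
  have "AE x in M. (SUP n\<in>{n. S n \<noteq> {}}. ereal (average ?T (S n) f (\<phi> x))) = \<infinity>"
    using AE by (simp only: AE_embed_measure'[OF inj])
  then have "AE x in M. (SUP n\<in>{n. S n \<noteq> {}}. ereal (average T (S n) (\<lambda>x. f (\<phi> x)) x)) = \<infinity>"
    by (rule AE_mp) (rule AE_I2, simp add: average_def \<psi>)
  then show "\<exists>f\<in>Lp p M.
      AE x in M. (SUP n\<in>{n. S n \<noteq> {}}. ereal (average T (S n) f x)) = \<infinity>"
    using Lp by (rule bexI)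
qed

end

theory Submission
  imports Defs "HOL-Real_Asymp.Real_Asymp"
begin

text \<open>
  Write \<open>D\<^sub>N = D \<inter> cube N\<close>. The set sought is \<open>S = D \<union> (\<Union>k. E k)\<close>, where the block \<open>E k\<close> is a finite set
  disjoint from \<open>D\<close> in the shell between the cubes of radius \<open>n k\<close> and \<open>2 * n k\<close>, and has about
  \<open>\<epsilon> k\<close> times as many points as \<open>D\<close> has in the inner cube. The radii grow so fast that all blocks up
  to the \<open>k\<close>-th together have at most \<open>2 * \<epsilon> k\<close> times as many points as \<open>D\<close> has in that cube. Sparseness
  of \<open>D\<close> enters twice: it leaves room for the blocks, even inside a prescribed residue class,
  and it provides arbitrarily large \<open>n\<close> with \<open>#D\<^bsub>2n\<^esub> \<le> 2\<^sup>d #D\<^sub>n\<close>, so that a block still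
  weighs about \<open>\<epsilon> k\<close> in the average over \<open>S\<close> once it has been passed completely.

  \<^bold>\<open>Good for \<open>p > q\<close>.\<close> The averages over \<open>S\<close> and over \<open>D\<close> differ by a factor tending to \<open>1\<close> and by the
  contribution of the blocks. From radius \<open>n k\<close> to radius \<open>n (k + 1)\<close> this contribution is at most
  \<open>G k = (\<Sum>g. \<bar>f \<circ> T g\<bar>) / #D\<^bsub>n k\<^esub>\<close>, the sum running over the blocks up to the \<open>k\<close>-th, and
  the norm of \<open>G k\<close> in \<open>L\<^sup>p\<close> is at most \<open>2 * \<epsilon> k\<close> times that of \<open>f\<close>. With
  \<open>\<epsilon> k\<close> equal to \<open>((1 + ln (k + 1))\<^sup>3 / (k + 1)) powr (1 / q)\<close> the series \<open>\<Sum>k. \<epsilon> k powr p\<close> converges for every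
  \<open>p > q\<close>; hence \<open>\<Sum>k. G k powr p\<close> is integrable and \<open>G k\<close> tends to \<open>0\<close> almost everywhere
  (\<open>universally_pointwise_good_perturbed\<close>).

  \<^bold>\<open>Sweeping out at \<open>q\<close>.\<close> The \<open>q\<close>-th powers of the weights have a divergent sum, and arithmetic makes
  this visible in every free action. The blocks with \<open>2\<^bsup>jd\<^esup> \<le> k < 2\<^bsup>(j+1)d\<^esup>\<close> are chosen inside
  residue classes modulo \<open>2\<^sup>j\<close> and use each of the \<open>2\<^bsup>jd\<^esup>\<close> classes. In a free action there is a
  set \<open>B j\<close> of measure at most a constant times \<open>2\<^bsup>-jd\<^esup>\<close> such that for almost every \<open>x\<close> some
  residue class modulo \<open>2\<^sup>j\<close>, restricted to a given large cube, carries \<open>x\<close> entirely into \<open>B j\<close>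
  (\<open>residue_trap\<close>). A function which is at least \<open>h j\<close> on \<open>B j\<close>, where
  \<open>h j\<close> equals \<open>(2\<^bsup>jd\<^esup> / (j + 1)\<^sup>2) powr (1 / q)\<close>, can be taken in \<open>L\<^sup>q\<close>, and at almost every point one of its
  averages over \<open>S\<close> is at least a constant times \<open>h j * \<epsilon> k\<close> with \<open>k\<close> as above. Since
  \<open>(h j * \<epsilon> k) powr q\<close> is at least a constant times \<open>j\<close>, the supremum is infinite
  (\<open>universally_sweeping_out_perturbed\<close>).
\<close>

section \<open>Counting lattice points\<close>

lemma card_vec_box:
  assumes "finite A"
  shows "finite {z :: 'a ^ 'd. \<forall>i. z $ i \<in> A}"
    and "card {z :: 'a ^ 'd. \<forall>i. z $ i \<in> A} = card A ^ CARD('d)"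
proof -
  have bij: "bij_betw vec_nth {z :: 'a ^ 'd. \<forall>i. z $ i \<in> A} (UNIV \<rightarrow>\<^sub>E A)"
    by (rule bij_betwI[where g = vec_lambda]) auto
  show "finite {z :: 'a ^ 'd. \<forall>i. z $ i \<in> A}"
    using bij_betw_finite[OF bij] assms by (simp add: finite_PiE)
  show "card {z :: 'a ^ 'd. \<forall>i. z $ i \<in> A} = card A ^ CARD('d)"
    using bij_betw_same_card[OF bij] by (simp add: card_PiE)
qed

lemma cube_eq_box: "cube N = {z. \<forall>i. z $ i \<in> {- int N..int N}}"
  by (auto simp: cube_def abs_le_iff minus_le_iff)

lemma finite_cube [simp]: "finite (cube N)"
  unfolding cube_eq_box by (rule card_vec_box) simp

lemma card_cube: "card (cube N :: (int ^ 'd) set) = (2 * N + 1) ^ CARD('d)"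
proof -
  have "nat (2 * int N + 1) = 2 * N + 1" by linarith
  then show ?thesis
    unfolding cube_eq_box by (subst card_vec_box) (simp_all del: atLeastAtMost_iff)
qed

lemma cube_mono: "m \<le> n \<Longrightarrow> cube m \<subseteq> cube n"
  unfolding cube_def by (auto intro: order_trans)

lemma uminus_in_cube: "z \<in> cube N \<Longrightarrow> - z \<in> cube N"
  by (simp add: cube_def)

lemma diff_in_cube: "z \<in> cube m \<Longrightarrow> w \<in> cube n \<Longrightarrow> z - w \<in> cube (m + n)"
  unfolding cube_def by (auto intro: order_trans[OF abs_triangle_ineq4 add_mono])

lemma in_some_cube: "\<exists>N. z \<in> cube N"
proof -
  have "\<bar>z $ i\<bar> \<le> int (nat (\<Sum>i\<in>UNIV. \<bar>z $ i\<bar>))" for i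
    using member_le_sum[of i UNIV "\<lambda>i. \<bar>z $ i\<bar>"] by (simp add: sum_nonneg)
  then show ?thesis
    unfolding cube_def by blast
qed

lemma finite_lattice_ball [simp]: "finite (lattice_ball N)"
  and card_lattice_ball_le: "card (lattice_ball N :: (int ^ 'd) set) \<le> (2 * N + 1) ^ CARD('d)"
proof -
  have sub: "lattice_ball N \<subseteq> (cube N :: (int ^ 'e) set)"
  proof
    fix z :: "int ^ 'e" assume z: "z \<in> lattice_ball N"
    have "\<bar>z $ i\<bar> \<le> int N" for i
      using component_le_norm_cart[of "\<chi> i. real_of_int (z $ i)" i] z
      unfolding lattice_ball_def by simp
    then show "z \<in> cube N"
      by (simp add: cube_def)
  qed
  show "finite (lattice_ball N)"
    using sub finite_cube by (rule finite_subset)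
  show "card (lattice_ball N :: (int ^ 'd) set) \<le> (2 * N + 1) ^ CARD('d)"
    using card_mono[OF finite_cube sub] by (simp add: card_cube)
qed

lemma cube_subset_lattice_ball: "(cube N :: (int ^ 'd) set) \<subseteq> lattice_ball (CARD('d) * N)"
proof
  fix z :: "int ^ 'd" assume z: "z \<in> cube N"
  have "\<bar>real_of_int (z $ i)\<bar> \<le> real N" for i
  proof -
    have "real_of_int \<bar>z $ i\<bar> \<le> real_of_int (int N)"
      using z unfolding of_int_le_iff by (simp add: cube_def)
    then show ?thesis by simp
  qed
  then have "norm ((\<chi> i. real_of_int (z $ i)) :: real ^ 'd) \<le> (\<Sum>i\<in>(UNIV :: 'd set). real N)"
    by (intro order_trans[OF norm_le_l1_cart] sum_mono) simp
  then show "z \<in> lattice_ball (CARD('d) * N)"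
    by (simp add: lattice_ball_def)
qed

text \<open>
  Sparseness is defined by balls; since the cube of radius \<open>N\<close> lies in the ball of radius
  \<open>d * N\<close>, it bounds the density in cubes up to the factor \<open>(3 * d) ^ d\<close>.
\<close>

lemma sparse_set_cube:
  fixes D :: "(int ^ 'd) set"
  assumes "sparse_set D"
  shows "(\<lambda>N. real (card (D \<inter> cube N)) / real N ^ CARD('d)) \<longlonglongrightarrow> 0"
proof (rule tendsto_sandwich[where f = "\<lambda>_. 0"])
  let ?d = "CARD('d)"
  let ?r = "\<lambda>N. real (card (D \<inter> lattice_ball N)) / real (card (lattice_ball N :: (int ^ 'd) set))"
  have "(\<lambda>N. ?r (?d * N)) \<longlonglongrightarrow> 0"
    using assms unfolding sparse_set_def
    by (rule filterlim_compose) (auto intro!: filterlim_subseq strict_monoI)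
  then show "(\<lambda>N. (3 * real ?d) ^ ?d * ?r (?d * N)) \<longlonglongrightarrow> 0"
    by (rule tendsto_mult_right_zero)
  show "\<forall>\<^sub>F N in sequentially. real (card (D \<inter> cube N)) / real N ^ ?d \<le> (3 * real ?d) ^ ?d * ?r (?d * N)"
  proof (rule eventually_sequentiallyI[of 1])
    fix N :: nat assume N: "1 \<le> N"
    let ?b = "card (lattice_ball (?d * N) :: (int ^ 'd) set)"
    have "card (D \<inter> cube N) \<le> card (D \<inter> lattice_ball (?d * N))"
      using cube_subset_lattice_ball by (intro card_mono) auto
    also have "real (card (D \<inter> lattice_ball (?d * N))) = ?r (?d * N) * ?b"
    proof -
      have "(0 :: int ^ 'd) \<in> lattice_ball (?d * N)"
        by (simp add: lattice_ball_def zero_vec_def[symmetric])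
      then have "?b \<noteq> 0"
        using card_0_eq[OF finite_lattice_ball] by (metis empty_iff)
      then show ?thesis by simp
    qed
    also have "\<dots> \<le> ?r (?d * N) * (3 * real ?d * real N) ^ ?d"
    proof (rule mult_left_mono)
      have "1 \<le> ?d * N"
        using N by (simp add: Suc_le_eq)
      then have "2 * (?d * N) + 1 \<le> 3 * ?d * N" by linarith
      then have "?b \<le> (3 * ?d * N) ^ ?d"
        by (intro order_trans[OF card_lattice_ball_le] power_mono) auto
      then have "real ?b \<le> real ((3 * ?d * N) ^ ?d)"
        by (simp only: of_nat_le_iff)
      then show "real ?b \<le> (3 * real ?d * real N) ^ ?d"
        by simp
    qed simp
    finally have "real (card (D \<inter> cube N)) \<le> ?r (?d * N) * (3 * real ?d * real N) ^ ?d"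
      by simp
    then show "real (card (D \<inter> cube N)) / real N ^ ?d \<le> (3 * real ?d) ^ ?d * ?r (?d * N)"
      using N by (simp add: pos_divide_le_eq power_mult_distrib mult_ac)
  qed
qed (simp_all add: eventually_sequentially)

lemma card_inter_cube_at_top:
  fixes D :: "(int ^ 'd) set"
  assumes "infinite D"
  shows "filterlim (\<lambda>N. real (card (D \<inter> cube N))) at_top sequentially"
  unfolding filterlim_at_top
proof
  fix Z :: real
  obtain F where F: "F \<subseteq> D" "finite F" "card F = nat \<lceil>Z\<rceil>"
    using infinite_arbitrarily_large[OF assms] by metis
  obtain r where r: "\<And>z :: int ^ 'd. z \<in> cube (r z)"
    using in_some_cube by metis
  show "\<forall>\<^sub>F N in sequentially. Z \<le> real (card (D \<inter> cube N))"
  proof (rule eventually_sequentiallyI[of "Max (insert 0 (r ` F))"])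
    fix N assume N: "Max (insert 0 (r ` F)) \<le> N"
    have "r z \<le> N" if "z \<in> F" for z
      using N F(2) that by simp
    then have "F \<subseteq> D \<inter> cube N"
      using F(1) r cube_mono by blast
    then have "card F \<le> card (D \<inter> cube N)"
      by (intro card_mono) auto
    then show "Z \<le> real (card (D \<inter> cube N))"
      using F(3) by linarith
  qed
qed

text \<open>
  If \<open>#D\<^bsub>2n\<^esub> > 2\<^sup>d #D\<^sub>n\<close> for all large \<open>n\<close>, then along
  \<open>n = 2\<^sup>j m\<close> the set \<open>D\<close> grows at least like a positive multiple of
  \<open>n\<^sup>d\<close>, against sparseness.
\<close>

lemma frequently_doubling:
  fixes D :: "(int ^ 'd) set"
  assumes "infinite D" "sparse_set D"
  shows "\<exists>\<^sub>F n in sequentially. card (D \<inter> cube (2 * n)) \<le> 2 ^ CARD('d) * card (D \<inter> cube n)"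
proof (rule ccontr)
  let ?b = "\<lambda>n. card (D \<inter> cube n)"
  assume "\<not> ?thesis"
  then have "\<forall>\<^sub>F n in sequentially. 2 ^ CARD('d) * ?b n < ?b (2 * n)"
    by (simp add: not_frequently not_le)
  moreover have "\<forall>\<^sub>F n in sequentially. 1 \<le> real (?b n)"
    using card_inter_cube_at_top[OF assms(1)] unfolding filterlim_at_top by blast
  ultimately have "\<forall>\<^sub>F n in sequentially. 2 ^ CARD('d) * ?b n < ?b (2 * n) \<and> 1 \<le> real (?b n) \<and> 1 \<le> n"
    using eventually_ge_at_top[of "1::nat"] by eventually_elim simp
  then obtain m where m: "\<And>n. m \<le> n \<Longrightarrow> 2 ^ CARD('d) * ?b n < ?b (2 * n) \<and> 1 \<le> real (?b n) \<and> 1 \<le> n"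
    unfolding eventually_sequentially by blast
  have grow: "(2 ^ j) ^ CARD('d) \<le> ?b (2 ^ j * m)" for j
  proof (induction j)
    case 0
    then show ?case using m[of m] by simp
  next
    case (Suc j)
    have "(2 ^ Suc j :: nat) ^ CARD('d) = 2 ^ CARD('d) * (2 ^ j) ^ CARD('d)"
      by (simp add: power_mult_distrib)
    also have "\<dots> \<le> 2 ^ CARD('d) * ?b (2 ^ j * m)"
      using Suc by simp
    also have "\<dots> \<le> ?b (2 * (2 ^ j * m))"
      using m[of "2 ^ j * m"] by simp
    finally show ?case by (simp add: mult.assoc)
  qed
  have m1: "1 \<le> m" using m[of m] by simp
  have "(\<lambda>j. real (?b (2 ^ j * m)) / real (2 ^ j * m) ^ CARD('d)) \<longlonglongrightarrow> 0"
    using sparse_set_cube[OF assms(2)]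
    by (rule filterlim_compose) (use m1 in \<open>auto intro!: filterlim_subseq strict_monoI\<close>)
  then have "\<forall>\<^sub>F j in sequentially. real (?b (2 ^ j * m)) / real (2 ^ j * m) ^ CARD('d) < 1 / real m ^ CARD('d)"
    using m1 by (intro order_tendstoD) auto
  then obtain j where "real (?b (2 ^ j * m)) / real (2 ^ j * m) ^ CARD('d) < 1 / real m ^ CARD('d)"
    unfolding eventually_sequentially by blast
  then have "real (?b (2 ^ j * m)) < (2 ^ j) ^ CARD('d)"
    using m1 by (simp add: power_mult_distrib field_simps)
  then have "real (?b (2 ^ j * m)) < real ((2 ^ j) ^ CARD('d))"
    by simp
  with grow[of j] show False
    by (simp only: of_nat_less_iff not_less[symmetric])
qed

text \<open>
  The points of the residue class whose coordinates all lie in \<open>{n<..2 * n}\<close> already suffice: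
  in each coordinate there are at least \<open>n div s\<close> of them.
\<close>

lemma card_residue_class_shell:
  fixes c :: "int ^ 'd"
  assumes s: "0 < s"
  shows "(n div s) ^ CARD('d) \<le>
    card {z \<in> cube (2 * n) - cube n. \<forall>i. int s dvd z $ i - c $ i}" (is "_ \<le> card ?F")
proof -
  let ?B = "{t :: nat ^ 'd. \<forall>i. t $ i \<in> {..<n div s}}"
  let ?z = "\<lambda>(t :: nat ^ 'd). (\<chi> i. int n + 1 + (c $ i - int n - 1) mod int s + int s * int (t $ i)) :: int ^ 'd"
  have "inj_on ?z ?B"
    using s by (auto simp: inj_on_def vec_eq_iff)
  moreover have "?z ` ?B \<subseteq> ?F"
  proof safe
    fix t :: "nat ^ 'd" assume t: "\<forall>i. t $ i \<in> {..<n div s}"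
    have lo: "int n < ?z t $ i" for i
      using s by (simp add: add_pos_nonneg)
    have hi: "?z t $ i \<le> 2 * int n" for i
    proof -
      have "s * Suc (t $ i) \<le> s * (n div s)"
        using t by (intro mult_le_mono2) (simp add: Suc_le_eq)
      also have "\<dots> \<le> n" by simp
      finally have "int s * int (t $ i) + int s \<le> int n"
        by (simp add: algebra_simps flip: of_nat_mult of_nat_add)
      moreover have "(c $ i - int n - 1) mod int s < int s"
        using s by simp
      ultimately show ?thesis by simp
    qed
    show "?z t \<in> cube (2 * n)"
      using lo hi by (auto simp: cube_def abs_le_iff intro: order_trans[of _ "0::int"] less_imp_le simp del: vec_lambda_beta) (smt (verit) lo of_nat_0_le_iff)
    show False if "?z t \<in> cube n"
      using lo[of undefined] that by (simp add: cube_def del: vec_lambda_beta) (smt (verit))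
    show "int s dvd ?z t $ i - c $ i" for i
    proof -
      have "?z t $ i - c $ i = int s * int (t $ i) - ((c $ i - int n - 1) - (c $ i - int n - 1) mod int s)"
        by simp
      then show ?thesis by (metis dvd_diff dvd_minus_mod dvd_triv_left)
    qed
  qed
  ultimately have "card ?B \<le> card ?F"
    by (intro card_inj_on_le) auto
  then show ?thesis
    by (simp add: card_vec_box del: lessThan_iff)
qed

section \<open>Blocks in residue classes outside a sparse set\<close>

text \<open>
  For large \<open>n\<close> the residue class has at least a fixed multiple of \<open>n\<^sup>d\<close>
  points in the shell, whereas \<open>D\<close> has only \<open>o(n\<^sup>d)\<close> points in the cube of
  radius \<open>2 * n\<close>; so a subset of the class of size
  \<open>\<lceil>\<epsilon> * #D\<^sub>n\<rceil>\<close> avoiding \<open>D\<close> exists. The cube of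
  radius \<open>m\<close> stands for all blocks chosen earlier.
\<close>

lemma sparse_block:
  fixes D :: "(int ^ 'd) set" and c :: "int ^ 'd" and \<epsilon> :: real
  assumes D: "infinite D" "sparse_set D" and \<epsilon>: "0 < \<epsilon>" and s: "0 < s"
  shows "\<exists>n E. m \<le> n \<and> E \<subseteq> cube (2 * n) - cube n - D \<and> (\<forall>g\<in>E. \<forall>i. int s dvd g $ i - c $ i) \<and>
    \<epsilon> * card (D \<inter> cube n) \<le> card E \<and>
    card (cube m :: (int ^ 'd) set) + card E \<le> 2 * \<epsilon> * card (D \<inter> cube n) \<and>
    card (D \<inter> cube (2 * n)) \<le> 2 ^ CARD('d) * card (D \<inter> cube n) \<and> 0 < card (D \<inter> cube n)"
proof -
  let ?d = "CARD('d)"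
  define b where "b n = real (card (D \<inter> cube n))" for n
  define K where "K = real (card (cube m :: (int ^ 'd) set))"
  have b_top: "filterlim b at_top sequentially"
    using card_inter_cube_at_top[OF D(1)] by (simp add: b_def[abs_def])
  have b_lim: "(\<lambda>n. b n / real n ^ ?d) \<longlonglongrightarrow> 0"
    using sparse_set_cube[OF D(2)] by (simp add: b_def)
  have "(\<lambda>n. b (2 * n) / real (2 * n) ^ ?d) \<longlonglongrightarrow> 0"
    using b_lim by (rule filterlim_compose) (auto intro!: filterlim_subseq strict_monoI)
  moreover have "(\<lambda>n. 1 / real n ^ ?d) \<longlonglongrightarrow> 0"
    by (intro tendsto_divide_0[OF tendsto_const] filterlim_at_top_imp_at_infinity
        filterlim_pow_at_top filterlim_real_sequentially) simp
  ultimately have "(\<lambda>n. 2 ^ ?d * (b (2 * n) / real (2 * n) ^ ?d) + \<epsilon> * (b n / real n ^ ?d) + 1 / real n ^ ?d)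
      \<longlonglongrightarrow> 2 ^ ?d * 0 + \<epsilon> * 0 + 0"
    using b_lim by (intro tendsto_intros)
  then have "\<forall>\<^sub>F n in sequentially. 2 ^ ?d * (b (2 * n) / real (2 * n) ^ ?d) + \<epsilon> * (b n / real n ^ ?d) +
      1 / real n ^ ?d < (1 / (2 * real s)) ^ ?d"
    using s by (intro order_tendstoD) auto
  \<comment> \<open>the threshold \<open>(1 / (2 * s)) ^ d\<close> is the right one because \<open>n / (2 * s) \<le> n div s\<close> as soon as \<open>s \<le> n\<close>\<close>
  then have "\<forall>\<^sub>F n in sequentially. b (2 * n) + \<epsilon> * b n + 1 < real ((n div s) ^ ?d)"
    using eventually_ge_at_top[of s]
  proof eventually_elim
    case (elim n)
    have n: "0 < n" using elim s by simp
    have "n < s * (n div s) + s"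
      using s dividend_less_div_times[of s n] by (simp add: mult.commute)
    moreover have "s \<le> s * (n div s)"
      using elim s mult_le_mono2[of 1 "n div s" s] by (simp add: Suc_le_eq div_greater_zero_iff)
    ultimately have "n \<le> 2 * s * (n div s)"
      by (simp only: mult.assoc)
    then have "real n \<le> real (2 * s * (n div s))"
      by (simp only: of_nat_le_iff)
    then have "real n / (2 * real s) \<le> real (n div s)"
      using s by (simp add: pos_divide_le_eq mult_ac)
    then have "(real n / (2 * real s)) ^ ?d \<le> real (n div s) ^ ?d"
      by (intro power_mono) auto
    moreover have "b (2 * n) + \<epsilon> * b n + 1 < (real n / (2 * real s)) ^ ?d"
      using elim(1) n by (simp add: power_divide power_mult_distrib field_simps)
    ultimately show ?case
      unfolding of_nat_power by linarith
  qed
  moreover have "\<forall>\<^sub>F n in sequentially. (K + 1) / \<epsilon> \<le> b n" "\<forall>\<^sub>F n in sequentially. 1 \<le> b n"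
    using b_top unfolding filterlim_at_top by blast+
  ultimately have "\<forall>\<^sub>F n in sequentially. m \<le> n \<and> 1 \<le> b n \<and> (K + 1) / \<epsilon> \<le> b n \<and>
      b (2 * n) + \<epsilon> * b n + 1 < real ((n div s) ^ ?d)"
    using eventually_ge_at_top[of m] by (intro eventually_conj)
  from frequently_ex[OF frequently_eventually_conj[OF frequently_doubling[OF D] this]]
  obtain n where n: "card (D \<inter> cube (2 * n)) \<le> 2 ^ ?d * card (D \<inter> cube n)" "m \<le> n" "1 \<le> b n"
      "(K + 1) / \<epsilon> \<le> b n" and room: "b (2 * n) + \<epsilon> * b n + 1 < real ((n div s) ^ ?d)"
    by blast
  define F where "F = {z \<in> cube (2 * n) - cube n. \<forall>i. int s dvd z $ i - c $ i}"
  \<comment> \<open>the block size; rounding up costs at most one point\<close>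
  define k where "k = nat \<lceil>\<epsilon> * b n\<rceil>"
  have "0 \<le> \<epsilon> * b n" using \<epsilon> n(3) by simp
  then have k: "\<epsilon> * b n \<le> real k" "real k \<le> \<epsilon> * b n + 1"
    unfolding k_def by linarith+
  have "real ((n div s) ^ ?d) \<le> real (card F)"
    unfolding F_def of_nat_le_iff using s by (rule card_residue_class_shell)
  moreover have "card F \<le> card (F - D) + card (D \<inter> cube (2 * n))"
  proof -
    have "F \<subseteq> (F - D) \<union> (D \<inter> cube (2 * n))" by (auto simp: F_def)
    moreover have "finite ((F - D) \<union> (D \<inter> cube (2 * n)))" by (auto simp: F_def)
    ultimately show ?thesis by (meson card_Un_le card_mono order_trans)
  qed
  then have "real (card F) \<le> real (card (F - D)) + b (2 * n)"
    unfolding b_def by simp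
  ultimately have "real k \<le> real (card (F - D))"
    using k room by linarith
  then obtain E where E: "E \<subseteq> F - D" "card E = k"
    using obtain_subset_with_card_n[of k "F - D"] by auto
  have "K + 1 \<le> \<epsilon> * b n"
    using n(4) \<epsilon> by (simp add: field_simps)
  then have "K + real (card E) \<le> 2 * \<epsilon> * b n"
    using k E(2) by simp
  with n E k show ?thesis
    unfolding b_def K_def F_def by (intro exI[of _ n] exI[of _ E]) auto
qed

text \<open>
  The assumption \<open>card_blocks_le\<close> counts all blocks up to the \<open>k\<close>-th against
  \<open>D\<close> at the inner radius of the \<open>k\<close>-th shell; it controls averages from that radius
  on. In contrast, \<open>doubling\<close> makes the \<open>k\<close>-th block noticeable at the outer radius.
\<close>

locale sparse_blocks =
  fixes D :: "(int ^ 'd) set" and \<epsilon> :: "nat \<Rightarrow> real" and n :: "nat \<Rightarrow> nat" and E :: "nat \<Rightarrow> (int ^ 'd) set"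
  assumes weight_pos: "0 < \<epsilon> k"
    and weight_lim: "\<epsilon> \<longlonglongrightarrow> 0"
    and radius_step: "2 * n k \<le> n (Suc k)"
    and block_subset: "E k \<subseteq> cube (2 * n k) - cube (n k) - D"
    and card_block_ge: "\<epsilon> k * card (D \<inter> cube (n k)) \<le> card (E k)"
    and card_blocks_le: "card (\<Union>j\<le>k. E j) \<le> 2 * \<epsilon> k * card (D \<inter> cube (n k))"
    and doubling: "card (D \<inter> cube (2 * n k)) \<le> 2 ^ CARD('d) * card (D \<inter> cube (n k))"
    and base_pos: "0 < card (D \<inter> cube (n k))"

lemma sparse_blocks_exist:
  fixes D :: "(int ^ 'd) set" and c :: "nat \<Rightarrow> int ^ 'd" and \<epsilon> :: "nat \<Rightarrow> real"
  assumes D: "infinite D" "sparse_set D"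
    and \<epsilon>: "\<And>k. 0 < \<epsilon> k" "\<epsilon> \<longlonglongrightarrow> 0" and s: "\<And>k. 0 < s k"
  shows "\<exists>n E. sparse_blocks D \<epsilon> n E \<and> (\<forall>k. \<forall>g\<in>E k. \<forall>i. int (s k) dvd g $ i - c k $ i)"
proof -
  define P where "P k m n E \<longleftrightarrow> m \<le> n \<and> E \<subseteq> cube (2 * n) - cube n - D \<and>
    (\<forall>g\<in>E. \<forall>i. int (s k) dvd g $ i - c k $ i) \<and>
    \<epsilon> k * card (D \<inter> cube n) \<le> card E \<and>
    card (cube m :: (int ^ 'd) set) + card E \<le> 2 * \<epsilon> k * card (D \<inter> cube n) \<and>
    card (D \<inter> cube (2 * n)) \<le> 2 ^ CARD('d) * card (D \<inter> cube n) \<and> 0 < card (D \<inter> cube n)" for k m n E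
  have block: "\<exists>n E. P k m n E" for k m
    unfolding P_def using D \<epsilon>(1) s by (rule sparse_block)
  have "\<exists>f. \<forall>k. (0 < k \<or> P k 0 (fst (f k)) (snd (f k))) \<and>
      P (Suc k) (2 * fst (f k)) (fst (f (Suc k))) (snd (f (Suc k)))"
    using block by (intro dependent_nat_choice) (simp_all add: split_paired_Ex)
  then obtain f where f: "0 < k \<or> P k 0 (fst (f k)) (snd (f k))"
      "P (Suc k) (2 * fst (f k)) (fst (f (Suc k))) (snd (f (Suc k)))" for k
    by blast
  define n where "n k = fst (f k)" for k
  define E where "E k = snd (f k)" for k
  have P0: "P 0 0 (n 0) (E 0)"
    using f(1)[of 0] by (simp add: n_def E_def)
  have PSuc: "P (Suc k) (2 * n k) (n (Suc k)) (E (Suc k))" for k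
    using f(2)[of k] by (simp add: n_def E_def)
  have P: "\<exists>m. P k m (n k) (E k)" for k
    using P0 PSuc by (cases k) blast+
  have step: "2 * n k \<le> n (Suc k)" for k
    using PSuc[of k] by (simp add: P_def)
  have mono: "n j \<le> n k" if "j \<le> k" for j k
  proof (rule lift_Suc_mono_le[OF _ that])
    show "n i \<le> n (Suc i)" for i
      using step[of i] by linarith
  qed
  have sub: "E k \<subseteq> cube (2 * n k) - cube (n k) - D" for k
    using P[of k] by (auto simp: P_def)
  have rest: "\<epsilon> k * card (D \<inter> cube (n k)) \<le> card (E k)"
      "card (D \<inter> cube (2 * n k)) \<le> 2 ^ CARD('d) * card (D \<inter> cube (n k))"
      "0 < card (D \<inter> cube (n k))" for k
    using P[of k] by (auto simp: P_def)
  have "sparse_blocks D \<epsilon> n E"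
  proof
    show "card (\<Union>j\<le>k. E j) \<le> 2 * \<epsilon> k * card (D \<inter> cube (n k))" for k
    proof (cases k)
      case 0
      then show ?thesis using P0 by (simp add: P_def)
    next
      case (Suc l)
      have "(\<Union>j\<le>k. E j) \<subseteq> cube (2 * n l) \<union> E k"
      proof safe
        fix j g assume g: "j \<le> k" "g \<in> E j" "g \<notin> E k"
        then have "j \<le> l" using Suc by (cases "j = k") auto
        then have "cube (2 * n j) \<subseteq> (cube (2 * n l) :: (int ^ 'd) set)"
          by (intro cube_mono) (simp add: mono)
        then show "g \<in> cube (2 * n l)"
          using sub[of j] g by blast
      qed
      moreover have "finite (cube (2 * n l) \<union> E k)"
        using sub[of k] by (auto intro: finite_subset[OF _ finite_cube])
      ultimately have "card (\<Union>j\<le>k. E j) \<le> card (cube (2 * n l) :: (int ^ 'd) set) + card (E k)"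
        by (meson card_Un_le card_mono order_trans)
      also have "real \<dots> \<le> 2 * \<epsilon> k * card (D \<inter> cube (n k))"
        using PSuc[of l] Suc by (simp add: P_def)
      finally show ?thesis by simp
    qed
  qed (rule \<epsilon> step sub rest)+
  moreover have "\<forall>k. \<forall>g\<in>E k. \<forall>i. int (s k) dvd g $ i - c k $ i"
    using P by (auto simp: P_def)
  ultimately show ?thesis by blast
qed

section \<open>Markers and residue traps in free actions\<close>

lemma card_cube_multiples_le:
  assumes "0 < s"
  shows "card {h \<in> cube K :: (int ^ 'd) set. \<forall>i. int s dvd h $ i} \<le> (2 * (K div s) + 1) ^ CARD('d)"
proof -
  have "{h \<in> cube K :: (int ^ 'd) set. \<forall>i. int s dvd h $ i} \<subseteq> (\<lambda>t :: int ^ 'd. \<chi> i. int s * t $ i) ` cube (K div s)"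
  proof
    fix h :: "int ^ 'd" assume h: "h \<in> {h \<in> cube K. \<forall>i. int s dvd h $ i}"
    have "\<bar>h $ i div int s\<bar> \<le> int (K div s)" for i
    proof -
      have "\<bar>h $ i\<bar> div int s \<le> int K div int s"
        using h \<open>0 < s\<close> by (intro zdiv_mono1) (auto simp: cube_def)
      moreover have "\<bar>h $ i div int s\<bar> = \<bar>h $ i\<bar> div int s"
      proof -
        obtain t where "h $ i = int s * t"
          using h by (auto elim: dvdE)
        then show ?thesis
          using \<open>0 < s\<close> by (simp add: abs_mult)
      qed
      ultimately show ?thesis by (simp add: zdiv_int)
    qed
    then have "(\<chi> i. h $ i div int s) \<in> cube (K div s)"
      by (simp add: cube_def)
    moreover have "h = (\<chi> i. int s * (\<chi> i. h $ i div int s) $ i)"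
      using h by (simp add: vec_eq_iff)
    ultimately show "h \<in> (\<lambda>t :: int ^ 'd. \<chi> i. int s * t $ i) ` cube (K div s)"
      by blast
  qed
  then have "card {h \<in> cube K :: (int ^ 'd) set. \<forall>i. int s dvd h $ i} \<le> card (cube (K div s) :: (int ^ 'd) set)"
    by (intro surj_card_le) simp_all
  then show ?thesis by (simp add: card_cube)
qed

context free_action
begin

lemma T_in_space: "x \<in> space M \<Longrightarrow> T g x \<in> space M"
  using measurable_space[OF measurable_T] .

lemma T_inverse: "x \<in> space M \<Longrightarrow> T (- g) (T g x) = x"
  using T_add[of x "- g" g] T_zero by simp

lemma measure_translate:
  assumes "A \<in> sets M"
  shows "measure M {x \<in> space M. T g x \<in> A} = measure M A"
proof -
  have "measure M A = measure (distr M M (T g)) A"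
    by (simp add: preserves)
  also have "\<dots> = measure M (T g -` A \<inter> space M)"
    using measurable_T assms by (rule measure_distr)
  also have "T g -` A \<inter> space M = {x \<in> space M. T g x \<in> A}"
    by auto
  finally show ?thesis by simp
qed

lemma AE_translate:
  assumes "AE x in M. P x"
  shows "AE x in M. P (T g x)"
proof -
  have "AE x in distr M M (T g). P x"
    unfolding preserves by (rule assms)
  then show ?thesis
    by (rule AE_distrD[OF measurable_T])
qed

lemma AE_not_fixed: "AE x in M. \<forall>g. g \<noteq> 0 \<longrightarrow> T g x \<noteq> x"
proof -
  have "AE x in M. T g x \<noteq> x" if "g \<noteq> 0" for g
    using AE_not_in[OF free[OF that]] AE_space by eventually_elim auto
  then have "AE x in M. \<forall>g\<in>UNIV. g \<noteq> 0 \<longrightarrow> T g x \<noteq> x"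
    by (subst AE_ball_countable) (auto intro!: countableI_type)
  then show ?thesis by simp
qed

text \<open>
  Countably many sets generate finer and finer finite partitions into cells. If \<open>x\<close> is not fixed
  by any \<open>g \<in> F\<close>, then some partition separates \<open>x\<close> from all
  \<open>T g x\<close>; the pieces collect the points separated in this way within one cell, and cells are
  indexed by finite lists, of which there are countably many.
\<close>

lemma separated_cover:
  assumes "finite F" "0 \<notin> F"
  obtains C :: "nat \<Rightarrow> 'a set"
  where "\<And>m. C m \<in> sets M" "\<And>m x g. x \<in> C m \<Longrightarrow> g \<in> F \<Longrightarrow> T g x \<notin> C m" "AE x in M. \<exists>m. x \<in> C m"
proof -
  obtain E :: "nat \<Rightarrow> 'a set" where range_E: "range E \<subseteq> sets M"
    and sep: "\<forall>x\<in>space M. \<forall>y\<in>space M. (\<forall>n. x \<in> E n \<longleftrightarrow> y \<in> E n) \<longrightarrow> x = y"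
    using separated unfolding countably_separated_def by (elim exE conjE)
  have E: "E n \<in> sets M" for n
    using range_E by auto
  define cell where "cell N l x \<longleftrightarrow> (\<forall>n\<in>{..<N}. x \<in> E n \<longleftrightarrow> n \<in> set l)" for N :: nat and l :: "nat list" and x
  \<comment> \<open>the piece belonging to the cell that the first \<open>N\<close> sets cut out by the membership pattern \<open>l\<close>\<close>
  define C where "C m = (case from_nat m of (N, l) \<Rightarrow>
      {x \<in> space M. cell N l x \<and> (\<forall>g\<in>F. \<not> cell N l (T g x))})" for m
  note [measurable] = measurable_T E
  have [measurable]: "Measurable.pred M (cell N l)" for N l
    unfolding cell_def by measurable
  show thesis
  proof
    show "C m \<in> sets M" for m
    proof -
      have "{x \<in> space M. cell N l x \<and> (\<forall>g\<in>F. \<not> cell N l (T g x))} \<in> sets M" for N l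
        using assms(1) by measurable
      then show ?thesis by (simp add: C_def split: prod.split)
    qed
    show "T g x \<notin> C m" if "x \<in> C m" "g \<in> F" for m x g
      using that by (auto simp: C_def split: prod.splits)
    show "AE x in M. \<exists>m. x \<in> C m"
      using AE_not_fixed AE_space
    proof eventually_elim
      case (elim x)
      have "\<exists>n. x \<in> E n \<longleftrightarrow> T g x \<notin> E n" if "g \<in> F" for g
        using sep[rule_format, of x "T g x"] elim T_in_space[of x g] that assms(2) by metis
      then obtain n where n: "\<And>g. g \<in> F \<Longrightarrow> x \<in> E (n g) \<longleftrightarrow> T g x \<notin> E (n g)"
        by metis
      define N where "N = Suc (Max (insert 0 (n ` F)))"
      obtain l where l: "set l = {k. k < N \<and> x \<in> E k}"
        using finite_list[of "{k. k < N \<and> x \<in> E k}"] by auto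
      have "n g < N" if "g \<in> F" for g
        using that assms(1) by (simp add: N_def less_Suc_eq_le)
      then have "\<not> cell N l (T g x)" if "g \<in> F" for g
        using n that by (auto simp: cell_def l intro!: bexI[of _ "n g"])
      moreover have "cell N l x"
        by (simp add: cell_def l)
      ultimately have "x \<in> C (to_nat (N, l))"
        using elim by (simp add: C_def)
      then show ?case by blast
    qed
  qed
qed

text \<open>
  The greedy construction: run through the pieces of \<open>separated_cover\<close> and add those points of
  the current piece whose translates by the cube all miss what has been collected. A point is left out only if
  some translate of it has been collected, so the cube translates of the result cover almost everything.
\<close>

lemma obtain_marker_set:
  obtains A where "A \<in> sets M" "\<And>x g. x \<in> A \<Longrightarrow> g \<in> cube R \<Longrightarrow> g \<noteq> 0 \<Longrightarrow> T g x \<notin> A"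
    "AE x in M. \<exists>g\<in>cube R. T g x \<in> A"
proof -
  obtain C :: "nat \<Rightarrow> 'a set" where C: "\<And>m. C m \<in> sets M"
      "\<And>m x g. x \<in> C m \<Longrightarrow> g \<in> cube R - {0} \<Longrightarrow> T g x \<notin> C m" "AE x in M. \<exists>m. x \<in> C m"
    using separated_cover[of "cube R - {0}"] by auto
  define A where "A = rec_nat {} (\<lambda>m B. B \<union> {x \<in> C m. \<forall>g\<in>cube R. T g x \<notin> B})"
  have A_0: "A 0 = {}" and A_Suc: "A (Suc m) = A m \<union> {x \<in> C m. \<forall>g\<in>cube R. T g x \<notin> A m}" for m
    by (simp_all add: A_def)
  note [measurable] = measurable_T
  have A_sets: "A m \<in> sets M" for m
  proof (induction m)
    case (Suc m)
    note [measurable] = Suc C(1)[of m]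
    have "{x \<in> space M. x \<in> C m \<and> (\<forall>g\<in>cube R. T g x \<notin> A m)} \<in> sets M"
      using finite_cube by measurable
    also have "{x \<in> space M. x \<in> C m \<and> (\<forall>g\<in>cube R. T g x \<notin> A m)} = {x \<in> C m. \<forall>g\<in>cube R. T g x \<notin> A m}"
      using sets.sets_into_space[OF C(1)[of m]] by auto
    finally show ?case unfolding A_Suc using Suc by (rule sets.Un[rotated])
  qed (simp add: A_0)
  have A_mono: "A m \<subseteq> A m'" if "m \<le> m'" for m m'
    using that by (rule lift_Suc_mono_le[rotated]) (auto simp: A_Suc)
  \<comment> \<open>if \<open>T g x\<close> is collected after \<open>x\<close>, the return translate by \<open>- g\<close> would have excluded it\<close>
  have A_sep: "T g x \<notin> A m" if "x \<in> A m" "g \<in> cube R" "g \<noteq> 0" for m x g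
    using that
  proof (induction m arbitrary: x g)
    case (Suc m)
    show ?case
    proof
      assume Tgx: "T g x \<in> A (Suc m)"
      have x: "x \<in> space M"
        using Suc.prems(1) A_sets sets.sets_into_space by blast
      show False
      proof (cases "x \<in> A m")
        case True
        then have "T (- g) (T g x) \<in> A m"
          using x by (simp add: T_inverse)
        then show False
          using Suc True Tgx uminus_in_cube[of g R] unfolding A_Suc by blast
      next
        case False
        then show False
          using Suc.prems Tgx C(2)[of x m g] unfolding A_Suc by blast
      qed
    qed
  qed (simp add: A_0)
  show thesis
  proof
    show "(\<Union>m. A m) \<in> sets M"
      using A_sets by blast
    show "T g x \<notin> (\<Union>m. A m)" if "x \<in> (\<Union>m. A m)" "g \<in> cube R" "g \<noteq> 0" for x g
    proof
      assume "T g x \<in> (\<Union>m. A m)"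
      with that obtain m m' where "x \<in> A m" "T g x \<in> A m'" by blast
      then have "x \<in> A (max m m')" "T g x \<in> A (max m m')"
        using A_mono[of m "max m m'"] A_mono[of m' "max m m'"] by auto
      then show False using A_sep that by blast
    qed
    show "AE x in M. \<exists>g\<in>cube R. T g x \<in> (\<Union>m. A m)"
      using C(3) AE_space
    proof eventually_elim
      case (elim x)
      then obtain m where m: "x \<in> C m" by blast
      show ?case
      proof (cases "\<forall>g\<in>cube R. T g x \<notin> A m")
        case True
        then have "T 0 x \<in> A (Suc m)"
          using m elim(2) by (simp add: A_Suc T_zero)
        moreover have "0 \<in> cube R" by (simp add: cube_def)
        ultimately show ?thesis by blast
      qed blast
    qed
  qed
qed

text \<open>
  The preimages of \<open>A\<close> under \<open>T h\<close>, \<open>h \<in> {0..R}\<^sup>d\<close>, are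
  pairwise disjoint, as differences of such \<open>h\<close> lie in the cube of radius \<open>R\<close>.
\<close>

lemma separated_measure_le:
  assumes A: "A \<in> sets M" "\<And>x g. x \<in> A \<Longrightarrow> g \<in> cube R \<Longrightarrow> g \<noteq> 0 \<Longrightarrow> T g x \<notin> A"
  shows "real (R + 1) ^ CARD('d) * measure M A \<le> measure M (space M)"
proof -
  let ?Q = "{z :: int ^ 'd. \<forall>i. z $ i \<in> {0..int R}}"
  let ?A = "\<lambda>h. {x \<in> space M. T h x \<in> A}"
  note [measurable] = measurable_T A(1)
  have Q: "finite ?Q" "card ?Q = (R + 1) ^ CARD('d)"
    using card_vec_box[of "{0..int R}", where 'd = 'd] by (simp_all add: nat_add_distrib)
  have disj: "disjoint_family_on ?A ?Q"
    unfolding disjoint_family_on_def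
  proof (intro ballI impI equals0I)
    fix h h' :: "int ^ 'd" and x
    assume h: "h \<in> ?Q" "h' \<in> ?Q" "h \<noteq> h'" and x: "x \<in> ?A h \<inter> ?A h'"
    have "(h' - h) $ i \<in> {- int R..int R}" for i
      using h(1,2)[THEN CollectD, THEN spec[of _ i]] by simp
    then have "h' - h \<in> cube R"
      unfolding cube_eq_box by blast
    moreover have "T (h' - h) (T h x) = T h' x"
      using x T_add[of x "h' - h" h] by simp
    ultimately show False
      using A(2)[of "T h x" "h' - h"] x h(3) by auto
  qed
  have "real (R + 1) ^ CARD('d) * measure M A = (\<Sum>h\<in>?Q. measure M (?A h))"
    using Q by (simp add: measure_translate[OF A(1)] del: atLeastAtMost_iff)
  also have "\<dots> = measure M (\<Union>h\<in>?Q. ?A h)"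
    using Q(1) disj by (intro finite_measure_finite_Union[symmetric]) auto
  also have "\<dots> \<le> measure M (space M)"
    by (rule bounded_measure)
  finally show ?thesis .
qed

text \<open>
  Take for \<open>B\<close> the points that some multiple of \<open>s\<close> in the cube of radius
  \<open>2 * R\<close> moves into a marker set \<open>A\<close>. If \<open>T r x \<in> A\<close> with
  \<open>r\<close> in the cube of radius \<open>R\<close>, then \<open>T (r - g)\<close> moves
  \<open>T g x\<close> into \<open>A\<close>, so \<open>T g x \<in> B\<close> for every \<open>g\<close>
  of the cube congruent to \<open>r\<close>. This takes the place of a Rokhlin tower: \<open>B\<close> has the
  measure of a set periodic modulo \<open>s\<close>, up to the constant \<open>5\<^sup>d\<close>, because
  \<open>A\<close> is at most \<open>R\<^bsup>-d\<^esup>\<close> of the space and there are at most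
  \<open>(5 * R / s)\<^sup>d\<close> multiples.
\<close>

lemma residue_trap:
  assumes s: "0 < s" "s \<le> R"
  obtains B where "B \<in> sets M" "measure M B \<le> 5 ^ CARD('d) * measure M (space M) / real s ^ CARD('d)"
    "AE x in M. \<exists>r. \<forall>g\<in>cube R. (\<forall>i. int s dvd r $ i - g $ i) \<longrightarrow> T g x \<in> B"
proof -
  obtain A where A: "A \<in> sets M" "\<And>x g. x \<in> A \<Longrightarrow> g \<in> cube R \<Longrightarrow> g \<noteq> 0 \<Longrightarrow> T g x \<notin> A"
    "AE x in M. \<exists>g\<in>cube R. T g x \<in> A"
    using obtain_marker_set[of R] by blast
  define P where "P = {h :: int ^ 'd. h \<in> cube (2 * R) \<and> (\<forall>i. int s dvd h $ i)}"
  define B where "B = (\<Union>h\<in>P. {x \<in> space M. T h x \<in> A})"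
  note [measurable] = measurable_T A(1)
  have P: "finite P"
    by (simp add: P_def)
  show thesis
  proof
    show "B \<in> sets M"
      unfolding B_def using P by (intro sets.finite_UN) auto
    let ?d = "CARD('d)"
    have "measure M B \<le> (\<Sum>h\<in>P. measure M {x \<in> space M. T h x \<in> A})"
      unfolding B_def using P by (intro measure_UNION_le) auto
    also have "\<dots> = real (card P) * measure M A"
      by (simp add: measure_translate[OF A(1)])
    also have "\<dots> \<le> (5 * real R / real s) ^ ?d * measure M A"
    proof (rule mult_right_mono)
      have "real (2 * (2 * R div s) + 1) \<le> 5 * real R / real s"
      proof -
        have "s * (2 * (2 * R div s) + 1) = 2 * (s * (2 * R div s)) + s"
          by (simp add: algebra_simps)
        also have "\<dots> \<le> 5 * R"
          using s(2) times_div_less_eq_dividend[of s "2 * R"] by linarith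
        finally have "s * (2 * (2 * R div s) + 1) \<le> 5 * R" .
        then have "real (s * (2 * (2 * R div s) + 1)) \<le> real (5 * R)"
          by (simp only: of_nat_le_iff)
        then show ?thesis
          using s(1) by (simp add: pos_le_divide_eq algebra_simps)
      qed
      then have "real (2 * (2 * R div s) + 1) ^ ?d \<le> (5 * real R / real s) ^ ?d"
        by (intro power_mono) auto
      moreover have "real (card P) \<le> real ((2 * (2 * R div s) + 1) ^ ?d)"
        unfolding of_nat_le_iff P_def using s(1) by (rule card_cube_multiples_le)
      ultimately show "real (card P) \<le> (5 * real R / real s) ^ ?d"
        unfolding of_nat_power by linarith
    qed simp
    also have "\<dots> = (5 / real s) ^ ?d * (real R ^ ?d * measure M A)"
      by (simp add: power_divide power_mult_distrib)
    also have "\<dots> \<le> (5 / real s) ^ ?d * measure M (space M)"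
    proof (rule mult_left_mono)
      have "real R ^ ?d * measure M A \<le> real (R + 1) ^ ?d * measure M A"
        by (intro mult_right_mono power_mono) auto
      also have "\<dots> \<le> measure M (space M)"
        using A(1,2) by (rule separated_measure_le)
      finally show "real R ^ ?d * measure M A \<le> measure M (space M)" .
    qed simp
    finally show "measure M B \<le> 5 ^ ?d * measure M (space M) / real s ^ ?d"
      by (simp add: power_divide)
    show "AE x in M. \<exists>r. \<forall>g\<in>cube R. (\<forall>i. int s dvd r $ i - g $ i) \<longrightarrow> T g x \<in> B"
      using A(3) AE_space
    proof eventually_elim
      case (elim x)
      then obtain r where r: "r \<in> cube R" "T r x \<in> A" by blast
      have "T g x \<in> B" if g: "g \<in> cube R" "\<forall>i. int s dvd r $ i - g $ i" for g
      proof -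
        have "r - g \<in> P"
          using diff_in_cube[OF r(1) g(1)] g(2) by (simp add: P_def mult_2)
        moreover have "T (r - g) (T g x) \<in> A"
          using r(2) T_add[of x "r - g" g] elim(2) by simp
        ultimately show ?thesis
          using T_in_space[OF elim(2)] by (auto simp: B_def)
      qed
      then show ?case by blast
    qed
  qed
qed

end

section \<open>Moments of weighted sums along orbits\<close>

text \<open>
  If one of the points is \<open>0\<close>, convexity amounts to \<open>u powr p \<le> u\<close> for
  \<open>0 < u < 1\<close>; otherwise \<open>powr_convex\<close> applies.
\<close>

lemma convex_on_powr:
  fixes p :: real
  assumes "1 \<le> p"
  shows "convex_on {0..} (\<lambda>x. x powr p)"
proof (rule convex_onI)
  fix t x y :: real
  assume t: "0 < t" "t < 1" and xy: "x \<in> {0..}" "y \<in> {0..}"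
  have shrink: "(u * z) powr p \<le> u * z powr p" if "0 < u" "u < 1" "0 \<le> z" for u z :: real
  proof -
    have "u powr p \<le> u powr 1"
      using that assms by (intro powr_mono') auto
    then show ?thesis
      using that by (simp add: powr_mult mult_right_mono)
  qed
  show "((1 - t) *\<^sub>R x + t *\<^sub>R y) powr p \<le> (1 - t) * x powr p + t * y powr p"
  proof (cases "x = 0 \<or> y = 0")
    case True
    then show ?thesis
      using shrink[of t y] shrink[of "1 - t" x] t xy by auto
  next
    case False
    then show ?thesis
      using convex_onD[OF powr_convex[OF assms], of t x y] t xy by simp
  qed
qed (rule convex_real_interval)

lemma powr_sum_le:
  fixes a :: "'i \<Rightarrow> real"
  assumes "finite U" "1 \<le> p" "\<And>g. g \<in> U \<Longrightarrow> 0 \<le> a g"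
  shows "(\<Sum>g\<in>U. a g) powr p \<le> real (card U) powr p * ((\<Sum>g\<in>U. a g powr p) / real (card U))"
proof (cases "U = {}")
  case False
  let ?m = "real (card U)"
  have m: "0 < ?m" using False assms(1) by (simp add: card_gt_0_iff)
  have "(\<Sum>g\<in>U. (1 / ?m) *\<^sub>R a g) powr p \<le> (\<Sum>g\<in>U. (1 / ?m) * a g powr p)"
    using m assms False by (intro convex_on_sum[OF _ _ convex_on_powr]) auto
  then have mean: "((\<Sum>g\<in>U. a g) / ?m) powr p \<le> (\<Sum>g\<in>U. a g powr p) / ?m"
    by (simp add: sum_divide_distrib)
  have "(\<Sum>g\<in>U. a g) powr p = ?m powr p * ((\<Sum>g\<in>U. a g) / ?m) powr p"
    using m assms by (simp add: powr_mult[symmetric] sum_nonneg)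
  also have "\<dots> \<le> ?m powr p * ((\<Sum>g\<in>U. a g powr p) / ?m)"
    using mean by (intro mult_left_mono) auto
  finally show ?thesis .
qed simp

text \<open>
  Jensen's inequality and the invariance of the measure; this is the triangle inequality in
  \<open>L\<^sup>p\<close>, stated for \<open>p\<close>-th powers.
\<close>

lemma (in free_action) nn_integral_weighted_sum_le:
  fixes f :: "'a \<Rightarrow> real"
  assumes U: "finite U" and p: "1 \<le> p" and f[measurable]: "f \<in> borel_measurable M" and b: "0 < b"
  shows "(\<integral>\<^sup>+x. ennreal (((\<Sum>g\<in>U. \<bar>f (T g x)\<bar>) / b) powr p) \<partial>M)
    \<le> ennreal ((real (card U) / b) powr p) * (\<integral>\<^sup>+x. ennreal (\<bar>f x\<bar> powr p) \<partial>M)"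
proof (cases "U = {}")
  case False
  note [measurable] = measurable_T
  let ?m = "real (card U)"
  have m: "0 < ?m" using False U by (simp add: card_gt_0_iff)
  have inv: "(\<integral>\<^sup>+x. ennreal (\<bar>f (T g x)\<bar> powr p) \<partial>M) = (\<integral>\<^sup>+x. ennreal (\<bar>f x\<bar> powr p) \<partial>M)" for g
  proof -
    have "(\<integral>\<^sup>+x. ennreal (\<bar>f x\<bar> powr p) \<partial>distr M M (T g)) = (\<integral>\<^sup>+x. ennreal (\<bar>f (T g x)\<bar> powr p) \<partial>M)"
      by (rule nn_integral_distr) measurable
    then show ?thesis by (simp only: preserves)
  qed
  have "((\<Sum>g\<in>U. \<bar>f (T g x)\<bar>) / b) powr p \<le> (?m / b) powr p / ?m * (\<Sum>g\<in>U. \<bar>f (T g x)\<bar> powr p)" for x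
  proof -
    have "((\<Sum>g\<in>U. \<bar>f (T g x)\<bar>) / b) powr p = (\<Sum>g\<in>U. \<bar>f (T g x)\<bar>) powr p / b powr p"
      by (rule powr_divide)
    also have "\<dots> \<le> ?m powr p * ((\<Sum>g\<in>U. \<bar>f (T g x)\<bar> powr p) / ?m) / b powr p"
      using U p by (intro divide_right_mono powr_sum_le) auto
    finally show ?thesis
      using b m by (simp add: powr_divide mult_ac)
  qed
  then have "(\<integral>\<^sup>+x. ennreal (((\<Sum>g\<in>U. \<bar>f (T g x)\<bar>) / b) powr p) \<partial>M)
      \<le> (\<integral>\<^sup>+x. ennreal ((?m / b) powr p / ?m * (\<Sum>g\<in>U. \<bar>f (T g x)\<bar> powr p)) \<partial>M)"
    by (intro nn_integral_mono ennreal_leI)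
  also have "\<dots> = (\<integral>\<^sup>+x. ennreal ((?m / b) powr p / ?m) * (\<Sum>g\<in>U. ennreal (\<bar>f (T g x)\<bar> powr p)) \<partial>M)"
    using m by (intro nn_integral_cong) (subst ennreal_mult, auto simp: sum_nonneg)
  also have "\<dots> = ennreal ((?m / b) powr p / ?m) * (\<Sum>g\<in>U. \<integral>\<^sup>+x. ennreal (\<bar>f (T g x)\<bar> powr p) \<partial>M)"
    by (simp add: nn_integral_cmult nn_integral_sum del: sum_ennreal)
  also have "\<dots> = ennreal ((?m / b) powr p / ?m) * ennreal ?m * (\<integral>\<^sup>+x. ennreal (\<bar>f x\<bar> powr p) \<partial>M)"
    by (simp add: inv mult.assoc ennreal_of_nat_eq_real_of_nat)
  also have "ennreal ((?m / b) powr p / ?m) * ennreal ?m = ennreal ((?m / b) powr p)"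
    using m by (subst ennreal_mult[symmetric]) auto
  finally show ?thesis .
qed simp

lemma AE_tendsto_zero_of_summable_moments:
  fixes G :: "nat \<Rightarrow> 'a \<Rightarrow> real"
  assumes [measurable]: "\<And>k. G k \<in> borel_measurable M" and G: "\<And>k x. 0 \<le> G k x" and p: "0 < p"
    and moment: "\<And>k. (\<integral>\<^sup>+x. ennreal (G k x powr p) \<partial>M) \<le> ennreal (c k)"
    and c: "\<And>k. 0 \<le> c k" "summable c"
  shows "AE x in M. (\<lambda>k. G k x) \<longlonglongrightarrow> 0"
proof -
  have "(\<integral>\<^sup>+x. (\<Sum>k. ennreal (G k x powr p)) \<partial>M) = (\<Sum>k. \<integral>\<^sup>+x. ennreal (G k x powr p) \<partial>M)"
    by (rule nn_integral_suminf) measurable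
  also have "\<dots> \<le> (\<Sum>k. ennreal (c k))"
    using moment by (intro suminf_le) auto
  also have "\<dots> = ennreal (suminf c)"
    using c by (rule suminf_ennreal2)
  finally have "(\<integral>\<^sup>+x. (\<Sum>k. ennreal (G k x powr p)) \<partial>M) \<noteq> \<infinity>"
    by (auto simp: top_unique)
  then have "AE x in M. (\<Sum>k. ennreal (G k x powr p)) \<noteq> \<infinity>"
    by (rule nn_integral_PInf_AE[rotated]) measurable
  then show ?thesis
  proof eventually_elim
    case (elim x)
    then have "summable (\<lambda>k. G k x powr p)"
      by (intro summable_suminf_not_top) auto
    then have "(\<lambda>k. (G k x powr p) powr (1 / p)) \<longlonglongrightarrow> 0"
      using p by (intro tendsto_zero_powrI[OF summable_LIMSEQ_zero tendsto_const]) auto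
    then show ?case
      using p G by (simp add: powr_powr)
  qed
qed

lemma nonempty_indices_eq:
  assumes "\<forall>\<^sub>F n in sequentially. S n \<noteq> {}"
  shows "nonempty_indices S = sequentially"
proof -
  have "sequentially \<le> principal {n. S n \<noteq> {}}"
    unfolding le_principal using assms by simp
  then show ?thesis
    unfolding nonempty_indices_def by (rule inf_absorb1)
qed

section \<open>The perturbed set is good\<close>

context sparse_blocks
begin

definition perturbed :: "(int ^ 'd) set" where
  "perturbed = D \<union> (\<Union>k. E k)"

abbreviation blocks_upto :: "nat \<Rightarrow> (int ^ 'd) set" where
  "blocks_upto k \<equiv> \<Union>j\<le>k. E j"

lemma finite_block [simp]: "finite (E k)"
proof (rule finite_subset[OF _ finite_cube])
  show "E k \<subseteq> cube (2 * n k)" using block_subset[of k] by blast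
qed

lemma card_blocks_ratio_le: "real (card (blocks_upto k)) / card (D \<inter> cube (n k)) \<le> 2 * \<epsilon> k"
proof -
  have "0 < real (card (D \<inter> cube (n k)))"
    unfolding of_nat_0_less_iff by (rule base_pos)
  from pos_divide_le_eq[OF this] card_blocks_le show ?thesis
    by (rule iffD2)
qed

lemma radius_pos: "0 < n k"
proof (rule ccontr)
  assume "\<not> 0 < n k"
  then have "E k = {}" using block_subset[of k] by simp
  then show False
    using card_block_ge[of k] weight_pos[of k] base_pos[of k] by (simp add: mult_le_0_iff)
qed

lemma strict_mono_radius: "strict_mono n"
proof (rule strict_monoI_Suc)
  show "n k < n (Suc k)" for k
    using radius_step[of k] radius_pos[of k] by linarith
qed

lemma excess_subset_blocks:
  assumes "N \<le> n (Suc k)"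
  shows "(perturbed \<inter> cube N) - D \<subseteq> blocks_upto k"
proof
  fix g assume g: "g \<in> (perturbed \<inter> cube N) - D"
  then obtain j where j: "g \<in> E j" by (auto simp: perturbed_def)
  have "j \<le> k"
  proof (rule ccontr)
    assume "\<not> j \<le> k"
    then have "n (Suc k) \<le> n j"
      using strict_mono_radius by (simp add: strict_mono_less_eq)
    then have "g \<in> cube (n j)"
      using g assms cube_mono[of N "n j"] by auto
    then show False using block_subset j by blast
  qed
  then show "g \<in> blocks_upto k" using j by blast
qed

lemma radius_bracket:
  assumes "n k\<^sub>0 \<le> N"
  obtains k where "k\<^sub>0 \<le> k" "n k \<le> N" "N \<le> n (Suc k)"
proof -
  let ?K = "{k. n k \<le> N}"
  have "?K \<subseteq> {..N}"
  proof
    fix k assume "k \<in> ?K"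
    with strict_mono_imp_increasing[OF strict_mono_radius, of k] show "k \<in> {..N}"
      by simp
  qed
  then have fin: "finite ?K"
    by (rule finite_subset) simp
  have "k\<^sub>0 \<in> ?K" using assms by simp
  then have "Max ?K \<in> ?K" "k\<^sub>0 \<le> Max ?K"
    using fin Max_in[OF fin] Max_ge[OF fin] by blast+
  moreover have "Suc (Max ?K) \<notin> ?K"
    using Max_ge[OF fin, of "Suc (Max ?K)"] by auto
  ultimately show thesis
    by (intro that[of "Max ?K"]) auto
qed

text \<open>
  Between two consecutive radii \<open>n k\<close> and \<open>n (Suc k)\<close> the sum over the added
  points grows at most to the sum over the blocks up to the \<open>k\<close>-th, while the denominator is at
  least the one at \<open>n k\<close>. Constant \<open>F\<close> gives the perturbation property;
  \<open>F g = \<bar>f (T g x)\<bar>\<close> gives convergence of averages.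
\<close>

lemma excess_tendsto_zero:
  fixes F :: "int ^ 'd \<Rightarrow> real"
  assumes F: "\<And>g. 0 \<le> F g"
    and lim: "(\<lambda>k. (\<Sum>g\<in>blocks_upto k. F g) / card (D \<inter> cube (n k))) \<longlonglongrightarrow> 0"
  shows "(\<lambda>N. (\<Sum>g\<in>(perturbed \<inter> cube N) - D. F g) / card (D \<inter> cube N)) \<longlonglongrightarrow> 0"
proof (rule LIMSEQ_I)
  fix e :: real assume "0 < e"
  then obtain k\<^sub>0 where k\<^sub>0: "\<And>k. k\<^sub>0 \<le> k \<Longrightarrow> \<bar>(\<Sum>g\<in>blocks_upto k. F g) / card (D \<inter> cube (n k))\<bar> < e"
    using LIMSEQ_D[OF lim] by auto
  have "norm ((\<Sum>g\<in>(perturbed \<inter> cube N) - D. F g) / card (D \<inter> cube N) - 0) < e" if "n k\<^sub>0 \<le> N" for N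
  proof -
    obtain k where k: "k\<^sub>0 \<le> k" "n k \<le> N" "N \<le> n (Suc k)"
      using \<open>n k\<^sub>0 \<le> N\<close> by (rule radius_bracket)
    have "card (D \<inter> cube (n k)) \<le> card (D \<inter> cube N)"
      using cube_mono[OF k(2)] by (intro card_mono) auto
    then have "(\<Sum>g\<in>(perturbed \<inter> cube N) - D. F g) / card (D \<inter> cube N)
        \<le> (\<Sum>g\<in>blocks_upto k. F g) / card (D \<inter> cube (n k))"
      using F base_pos[of k] excess_subset_blocks[OF k(3)]
      by (intro frac_le sum_nonneg sum_mono2) auto
    then show ?thesis
      using k\<^sub>0[OF k(1)] F by (simp add: sum_nonneg)
  qed
  then show "\<exists>N\<^sub>0. \<forall>N\<ge>N\<^sub>0. norm ((\<Sum>g\<in>(perturbed \<inter> cube N) - D. F g) / card (D \<inter> cube N) - 0) < e"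
    by blast
qed

lemma card_excess_tendsto_zero:
  "(\<lambda>N. real (card ((perturbed \<inter> cube N) - D)) / card (D \<inter> cube N)) \<longlonglongrightarrow> 0"
proof -
  have "(\<lambda>k. real (card (blocks_upto k)) / card (D \<inter> cube (n k))) \<longlonglongrightarrow> 0"
  proof (rule tendsto_sandwich[where f = "\<lambda>_. 0" and h = "\<lambda>k. 2 * \<epsilon> k"])
    have "real (card (blocks_upto k)) / card (D \<inter> cube (n k)) \<le> 2 * \<epsilon> k" for k
      by (rule card_blocks_ratio_le)
    then show "\<forall>\<^sub>F k in sequentially. real (card (blocks_upto k)) / card (D \<inter> cube (n k)) \<le> 2 * \<epsilon> k"
      by (rule always_eventually[OF allI])
    show "(\<lambda>k. 2 * \<epsilon> k) \<longlonglongrightarrow> 0"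
      using weight_lim by (rule tendsto_mult_right_zero)
  qed simp_all
  then show ?thesis
    using excess_tendsto_zero[of "\<lambda>_. 1"] by simp
qed

lemma perturbation_perturbed: "perturbation (\<lambda>N. perturbed \<inter> cube N) (\<lambda>N. D \<inter> cube N)"
proof -
  have "((perturbed \<inter> cube N) - (D \<inter> cube N)) \<union> ((D \<inter> cube N) - (perturbed \<inter> cube N))
      = (perturbed \<inter> cube N) - D" for N
    by (auto simp: perturbed_def)
  then show ?thesis
    unfolding perturbation_def nonempty_indices_def
    using tendsto_mono[OF inf_le1 card_excess_tendsto_zero] by simp
qed

lemma eventually_base_pos: "\<forall>\<^sub>F N in sequentially. 0 < card (D \<inter> cube N)"
proof (rule eventually_sequentiallyI[of "n 0"])
  fix N assume "n 0 \<le> N"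
  then have "D \<inter> cube (n 0) \<subseteq> D \<inter> cube N"
    using cube_mono by (intro Int_mono) auto
  then have "card (D \<inter> cube (n 0)) \<le> card (D \<inter> cube N)"
    by (intro card_mono) simp_all
  with base_pos[of 0] show "0 < card (D \<inter> cube N)"
    by (rule order_less_le_trans)
qed

lemma card_perturbed_inter:
  "card (perturbed \<inter> cube N) = card (D \<inter> cube N) + card ((perturbed \<inter> cube N) - D)"
proof -
  have "perturbed \<inter> cube N = (D \<inter> cube N) \<union> ((perturbed \<inter> cube N) - D)"
    by (auto simp: perturbed_def)
  moreover have "card ((D \<inter> cube N) \<union> ((perturbed \<inter> cube N) - D)) =
      card (D \<inter> cube N) + card ((perturbed \<inter> cube N) - D)"
    by (rule card_Un_disjoint) auto
  ultimately show ?thesis by simp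
qed

lemma nonempty_indices_base: "nonempty_indices (\<lambda>N. D \<inter> cube N) = sequentially"
  by (rule nonempty_indices_eq, rule eventually_mono[OF eventually_base_pos]) auto

lemma nonempty_indices_perturbed: "nonempty_indices (\<lambda>N. perturbed \<inter> cube N) = sequentially"
  by (rule nonempty_indices_eq, rule eventually_mono[OF eventually_base_pos])
    (auto simp: perturbed_def card_gt_0_iff)

lemma card_ratio_tendsto_one:
  "(\<lambda>N. real (card (D \<inter> cube N)) / card (perturbed \<inter> cube N)) \<longlonglongrightarrow> 1"
proof -
  let ?r = "\<lambda>N. real (card ((perturbed \<inter> cube N) - D)) / card (D \<inter> cube N)"
  have "(\<lambda>N. 1 / (1 + ?r N)) \<longlonglongrightarrow> 1 / (1 + 0)"
    by (intro tendsto_intros card_excess_tendsto_zero) simp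
  moreover have "\<forall>\<^sub>F N in sequentially. 1 / (1 + ?r N) = real (card (D \<inter> cube N)) / card (perturbed \<inter> cube N)"
    using eventually_base_pos
  proof eventually_elim
    case (elim N)
    then have "1 + ?r N = real (card (perturbed \<inter> cube N)) / card (D \<inter> cube N)"
      by (simp add: card_perturbed_inter add_divide_distrib card_gt_0_iff)
    then show ?case by simp
  qed
  ultimately have "(\<lambda>N. real (card (D \<inter> cube N)) / card (perturbed \<inter> cube N)) \<longlonglongrightarrow> 1 / (1 + 0)"
    by (rule Lim_transform_eventually)
  then show ?thesis by simp
qed

lemma average_perturbed:
  assumes "0 < card (D \<inter> cube N)"
  shows "average T (perturbed \<inter> cube N) f x =
    real (card (D \<inter> cube N)) / card (perturbed \<inter> cube N) *
      (average T (D \<inter> cube N) f x + (\<Sum>g\<in>(perturbed \<inter> cube N) - D. f (T g x)) / card (D \<inter> cube N))"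
proof -
  have "perturbed \<inter> cube N = (D \<inter> cube N) \<union> ((perturbed \<inter> cube N) - D)"
    by (auto simp: perturbed_def)
  then have "(\<Sum>g\<in>perturbed \<inter> cube N. f (T g x)) =
      (\<Sum>g\<in>(D \<inter> cube N) \<union> ((perturbed \<inter> cube N) - D). f (T g x))"
    by simp
  also have "\<dots> = (\<Sum>g\<in>D \<inter> cube N. f (T g x)) + (\<Sum>g\<in>(perturbed \<inter> cube N) - D. f (T g x))"
    by (rule sum.union_disjoint) auto
  finally have split: "(\<Sum>g\<in>perturbed \<inter> cube N. f (T g x)) =
      (\<Sum>g\<in>D \<inter> cube N. f (T g x)) + (\<Sum>g\<in>(perturbed \<inter> cube N) - D. f (T g x))" .
  have cancel: "1 / c * (u + v) = b / c * (1 / b * u + v / b)" if "b \<noteq> 0" for b c u v :: real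
    using that by (cases "c = 0") (simp_all add: field_simps)
  have "real (card (D \<inter> cube N)) \<noteq> 0"
    using assms by linarith
  then show ?thesis
    unfolding average_def split by (rule cancel)
qed

lemma universally_pointwise_good_perturbed:
  assumes p: "1 \<le> p" and \<epsilon>_p: "summable (\<lambda>k. \<epsilon> k powr p)"
    and good: "universally_pointwise_good TYPE('a) p (\<lambda>N. D \<inter> cube N)"
  shows "universally_pointwise_good TYPE('a) p (\<lambda>N. perturbed \<inter> cube N)"
  unfolding universally_pointwise_good_def nonempty_indices_perturbed
proof (intro conjI allI impI ballI)
  fix M :: "'a measure" and T :: "int ^ 'd \<Rightarrow> 'a \<Rightarrow> 'a" and f
  assume act: "free_action M T" and f: "f \<in> Lp p M"
  interpret free_action M T by (rule act)
  note [measurable] = measurable_T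
  have [measurable]: "f \<in> borel_measurable M" and int: "integrable M (\<lambda>x. \<bar>f x\<bar> powr p)"
    using f by (auto simp: Lp_def)
  define I where "I = (\<integral>x. \<bar>f x\<bar> powr p \<partial>M)"
  have I: "0 \<le> I" "(\<integral>\<^sup>+x. ennreal (\<bar>f x\<bar> powr p) \<partial>M) = ennreal I"
    unfolding I_def using int by (auto intro!: nn_integral_eq_integral)
  define G where "G k x = (\<Sum>g\<in>blocks_upto k. \<bar>f (T g x)\<bar>) / card (D \<inter> cube (n k))" for k x
  have "AE x in M. (\<lambda>k. G k x) \<longlonglongrightarrow> 0"
  proof (rule AE_tendsto_zero_of_summable_moments)
    show "G k \<in> borel_measurable M" for k
      unfolding G_def by measurable
    show "0 \<le> G k x" for k x
      unfolding G_def by (intro divide_nonneg_nonneg sum_nonneg) auto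
    show "0 < p" using p by simp
    show "(\<integral>\<^sup>+x. ennreal (G k x powr p) \<partial>M) \<le> ennreal ((2 powr p * I) * \<epsilon> k powr p)" for k
    proof -
      have "(\<integral>\<^sup>+x. ennreal (G k x powr p) \<partial>M)
          \<le> ennreal ((real (card (blocks_upto k)) / card (D \<inter> cube (n k))) powr p) * ennreal I"
        unfolding G_def I(2)[symmetric] using p base_pos[of k]
        by (intro nn_integral_weighted_sum_le) auto
      also have "\<dots> \<le> ennreal ((2 * \<epsilon> k) powr p) * ennreal I"
        using p card_blocks_ratio_le[of k] by (intro mult_right_mono ennreal_leI powr_mono2) simp_all
      also have "\<dots> = ennreal ((2 powr p * I) * \<epsilon> k powr p)"
        using I(1) weight_pos[of k] by (simp add: ennreal_mult[symmetric] powr_mult mult_ac)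
      finally show ?thesis .
    qed
    show "0 \<le> (2 powr p * I) * \<epsilon> k powr p" for k
      using I(1) by simp
    show "summable (\<lambda>k. (2 powr p * I) * \<epsilon> k powr p)"
      using \<epsilon>_p by (rule summable_mult)
  qed
  moreover have "AE x in M. \<exists>l. (\<lambda>N. average T (D \<inter> cube N) f x) \<longlonglongrightarrow> l"
    using good act f unfolding universally_pointwise_good_def nonempty_indices_base by blast
  ultimately show "AE x in M. \<exists>l. (\<lambda>N. average T (perturbed \<inter> cube N) f x) \<longlonglongrightarrow> l"
  proof eventually_elim
    case (elim x)
    then obtain l where l: "(\<lambda>N. average T (D \<inter> cube N) f x) \<longlonglongrightarrow> l" by blast
    let ?e = "\<lambda>N. (\<Sum>g\<in>(perturbed \<inter> cube N) - D. f (T g x)) / card (D \<inter> cube N)"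
    have "(\<lambda>N. (\<Sum>g\<in>(perturbed \<inter> cube N) - D. \<bar>f (T g x)\<bar>) / card (D \<inter> cube N)) \<longlonglongrightarrow> 0"
      using elim(1) unfolding G_def by (intro excess_tendsto_zero) auto
    then have "?e \<longlonglongrightarrow> 0"
      by (rule Lim_null_comparison[rotated])
        (auto intro!: always_eventually divide_right_mono sum_abs simp: abs_divide)
    then have "(\<lambda>N. real (card (D \<inter> cube N)) / card (perturbed \<inter> cube N) *
        (average T (D \<inter> cube N) f x + ?e N)) \<longlonglongrightarrow> 1 * (l + 0)"
      by (intro tendsto_intros card_ratio_tendsto_one l)
    moreover have "\<forall>\<^sub>F N in sequentially. real (card (D \<inter> cube N)) / card (perturbed \<inter> cube N) *
        (average T (D \<inter> cube N) f x + ?e N) = average T (perturbed \<inter> cube N) f x"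
      using eventually_base_pos by eventually_elim (simp only: average_perturbed)
    ultimately have "(\<lambda>N. average T (perturbed \<inter> cube N) f x) \<longlonglongrightarrow> 1 * (l + 0)"
      by (rule Lim_transform_eventually)
    then show ?case by blast
  qed
qed simp

section \<open>The perturbed set is sweeping out\<close>

text \<open>
  At radius \<open>2 * n k\<close> the whole block \<open>E k\<close> counts, and by doubling the set
  averaged over has still at most \<open>2\<^sup>d + 2 * e\<close> times as many points as
  \<open>D\<close> has at radius \<open>n k\<close>.
\<close>

lemma average_block_ge:
  assumes h: "0 \<le> h" and f: "\<And>g. 0 \<le> f (T g x)" "\<And>g. g \<in> E k \<Longrightarrow> h \<le> f (T g x)"
    and e: "\<epsilon> k \<le> e"
  shows "h * \<epsilon> k / (2 ^ CARD('d) + 2 * e) \<le> average T (perturbed \<inter> cube (2 * n k)) f x"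
proof -
  let ?b = "real (card (D \<inter> cube (n k)))"
  let ?S = "perturbed \<inter> cube (2 * n k)"
  have b: "0 < ?b" using base_pos by simp
  have "real (card (D \<inter> cube (2 * n k))) \<le> real (2 ^ CARD('d) * card (D \<inter> cube (n k)))"
    using doubling[of k] by (simp only: of_nat_le_iff)
  moreover have "card (?S - D) \<le> card (blocks_upto k)"
    using radius_step[of k] by (intro card_mono excess_subset_blocks) auto
  ultimately have "real (card ?S) \<le> 2 ^ CARD('d) * ?b + 2 * \<epsilon> k * ?b"
    using card_blocks_le[of k] by (simp add: card_perturbed_inter)
  also have "\<dots> \<le> (2 ^ CARD('d) + 2 * e) * ?b"
    using e b by (simp add: algebra_simps)
  finally have S_le: "real (card ?S) \<le> (2 ^ CARD('d) + 2 * e) * ?b" .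
  have E: "E k \<subseteq> ?S"
    using block_subset[of k] by (auto simp: perturbed_def)
  have "card (D \<inter> cube (n k)) \<le> card ?S"
    using cube_mono[of "n k" "2 * n k"] by (intro card_mono) (auto simp: perturbed_def)
  then have S_pos: "0 < real (card ?S)"
    using base_pos[of k] by simp
  have "(h * \<epsilon> k) / (2 ^ CARD('d) + 2 * e) = (h * (\<epsilon> k * ?b)) / ((2 ^ CARD('d) + 2 * e) * ?b)"
    using b by (simp add: card_gt_0_iff)
  also have "\<dots> \<le> (h * real (card (E k))) / card ?S"
    using h S_le S_pos weight_pos[of k] b card_block_ge[of k]
    by (intro frac_le mult_left_mono) auto
  also have "h * real (card (E k)) \<le> (\<Sum>g\<in>E k. f (T g x))"
    using sum_mono[of "E k" "\<lambda>_. h" "\<lambda>g. f (T g x)"] f(2) by (simp add: mult.commute)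
  also have "\<dots> \<le> (\<Sum>g\<in>?S. f (T g x))"
    using E f(1) by (intro sum_mono2) auto
  finally show ?thesis
    using S_pos by (simp add: average_def divide_right_mono)
qed

text \<open>
  The witness is \<open>f = (\<Sum>j. h j powr q * indicator (B j)) powr (1 / q)\<close> with
  residue traps \<open>B j\<close> for the modulus \<open>2\<^sup>j\<close>: the residue class that traps
  \<open>x\<close> contains a block \<open>E k\<close> with \<open>k \<in> K j\<close>, which therefore
  sees only values of \<open>f\<close> of size at least \<open>h j\<close>.
\<close>

lemma universally_sweeping_out_perturbed:
  fixes K :: "nat \<Rightarrow> nat set"
  assumes q: "0 < q" and K: "\<And>j. finite (K j)"
    and residues: "\<And>j r. \<exists>k\<in>K j. \<forall>g\<in>E k. \<forall>i. 2 ^ j dvd r $ i - g $ i"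
    and h: "\<And>j. 0 \<le> h j" "summable (\<lambda>j. h j powr q / (2 ^ j) ^ CARD('d))"
    and large: "\<And>C. \<exists>j. \<forall>k\<in>K j. C \<le> h j * \<epsilon> k"
  shows "universally_sweeping_out TYPE('a) q (\<lambda>N. perturbed \<inter> cube N)"
  unfolding universally_sweeping_out_def
proof (intro conjI allI impI)
  fix M :: "'a measure" and T :: "int ^ 'd \<Rightarrow> 'a \<Rightarrow> 'a"
  assume act: "free_action M T"
  interpret free_action M T by (rule act)
  let ?d = "CARD('d)"
  \<comment> \<open>a radius that contains all blocks of the group \<open>j\<close>\<close>
  define R where "R j = Max (insert (2 ^ j) ((\<lambda>k. 2 * n k) ` K j))" for j
  have R_ge: "y \<le> R j" if "y \<in> insert (2 ^ j) ((\<lambda>k. 2 * n k) ` K j)" for y j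
    unfolding R_def using that K[of j] by (intro Max_ge) simp_all
  have R: "2 ^ j \<le> R j" "k \<in> K j \<Longrightarrow> 2 * n k \<le> R j" for j k
    by (rule R_ge; simp)+
  have "\<exists>B. B \<in> sets M \<and> measure M B \<le> 5 ^ ?d * measure M (space M) / real (2 ^ j) ^ ?d \<and>
      (AE x in M. \<exists>r. \<forall>g\<in>cube (R j). (\<forall>i. int (2 ^ j) dvd r $ i - g $ i) \<longrightarrow> T g x \<in> B)" for j
  proof -
    have "0 < (2 :: nat) ^ j" by simp
    from residue_trap[OF this R(1)] show ?thesis by blast
  qed
  then have "\<exists>B. \<forall>j. B j \<in> sets M \<and> measure M (B j) \<le> 5 ^ ?d * measure M (space M) / real (2 ^ j) ^ ?d \<and>
      (AE x in M. \<exists>r. \<forall>g\<in>cube (R j). (\<forall>i. int (2 ^ j) dvd r $ i - g $ i) \<longrightarrow> T g x \<in> B j)"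
    by (intro choice allI)
  then obtain B where B[measurable]: "\<And>j. B j \<in> sets M"
    and B_le: "\<And>j. measure M (B j) \<le> 5 ^ ?d * measure M (space M) / real (2 ^ j) ^ ?d"
    and trap: "\<And>j. AE x in M. \<exists>r. \<forall>g\<in>cube (R j). (\<forall>i. int (2 ^ j) dvd r $ i - g $ i) \<longrightarrow> T g x \<in> B j"
    by blast
  define F where "F x = (\<Sum>j. ennreal (h j powr q) * indicator (B j) x)" for x
  have [measurable]: "F \<in> borel_measurable M"
    unfolding F_def by measurable
  have "(\<integral>\<^sup>+x. F x \<partial>M) = (\<Sum>j. \<integral>\<^sup>+x. ennreal (h j powr q) * indicator (B j) x \<partial>M)"
    unfolding F_def by (rule nn_integral_suminf) measurable
  also have "\<dots> = (\<Sum>j. ennreal (h j powr q) * emeasure M (B j))"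
    by (simp add: nn_integral_cmult_indicator)
  also have "\<dots> \<le> (\<Sum>j. ennreal (5 ^ ?d * measure M (space M) * (h j powr q / (2 ^ j) ^ ?d)))"
  proof (intro suminf_le summableI)
    fix j
    have "ennreal (h j powr q) * emeasure M (B j) = ennreal (h j powr q * measure M (B j))"
      by (simp add: emeasure_eq_measure ennreal_mult)
    also have "\<dots> \<le> ennreal (h j powr q * (5 ^ ?d * measure M (space M) / real (2 ^ j) ^ ?d))"
      using B_le[of j] by (intro ennreal_leI mult_left_mono) auto
    finally show "ennreal (h j powr q) * emeasure M (B j)
        \<le> ennreal (5 ^ ?d * measure M (space M) * (h j powr q / (2 ^ j) ^ ?d))"
      by (simp add: mult_ac)
  qed
  also have "\<dots> = ennreal (\<Sum>j. 5 ^ ?d * measure M (space M) * (h j powr q / (2 ^ j) ^ ?d))"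
    using h(2) by (intro suminf_ennreal2 summable_mult) auto
  finally have F_int: "(\<integral>\<^sup>+x. F x \<partial>M) < \<infinity>"
    by (simp add: le_less_trans)
  then have F_fin: "AE x in M. F x \<noteq> \<infinity>"
    by (intro nn_integral_PInf_AE) auto
  define f where "f x = enn2real (F x) powr (1 / q)" for x
  have f_nonneg: "0 \<le> f x" for x
    by (simp add: f_def)
  have f_ge: "h j \<le> f x" if "x \<in> B j" "F x \<noteq> \<infinity>" for j x
  proof -
    have "ennreal (h j powr q) \<le> F x"
      unfolding F_def using sum_le_suminf[OF summableI, of "{j}" "\<lambda>j. ennreal (h j powr q) * indicator (B j) x"] that(1)
      by simp
    then have "h j powr q \<le> enn2real (F x)"
      using that(2) enn2real_mono[of "ennreal (h j powr q)" "F x"] by (simp add: less_top)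
    then have "(h j powr q) powr (1 / q) \<le> f x"
      unfolding f_def using q by (intro powr_mono2) auto
    then show ?thesis
      using q h(1)[of j] by (simp add: powr_powr)
  qed
  have "f \<in> Lp q M"
  proof -
    have [measurable]: "f \<in> borel_measurable M"
      unfolding f_def by measurable
    have "integrable M (\<lambda>x. enn2real (F x))"
    proof (rule integrableI_nonneg)
      have "(\<integral>\<^sup>+x. ennreal (enn2real (F x)) \<partial>M) \<le> (\<integral>\<^sup>+x. F x \<partial>M)"
        by (intro nn_integral_mono) (simp add: ennreal_enn2real_if)
      then show "(\<integral>\<^sup>+x. ennreal (enn2real (F x)) \<partial>M) < \<infinity>"
        using F_int by (rule le_less_trans)
    qed auto
    then show ?thesis
      using q by (simp add: Lp_def f_def powr_powr)
  qed
  moreover have "AE x in M. (SUP N\<in>{N. perturbed \<inter> cube N \<noteq> {}}. ereal (average T (perturbed \<inter> cube N) f x)) = \<infinity>"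
  proof -
    obtain e where e: "\<And>k. \<epsilon> k \<le> e"
      using convergent_imp_Bseq[OF convergentI[OF weight_lim]] unfolding Bseq_def
      by (metis abs_le_D1 real_norm_def)
    define L where "L = 2 ^ ?d + 2 * e"
    have L: "0 < L"
      unfolding L_def using e[of 0] weight_pos[of 0] by (intro add_pos_nonneg) auto
    have "AE x in M. \<forall>g\<in>UNIV. F (T g x) \<noteq> \<infinity>"
      using AE_translate[OF F_fin] by (subst AE_ball_countable) simp_all
    moreover have "AE x in M. \<forall>j. \<exists>r. \<forall>g\<in>cube (R j). (\<forall>i. int (2 ^ j) dvd r $ i - g $ i) \<longrightarrow> T g x \<in> B j"
      using trap by (subst AE_all_countable) blast
    ultimately show ?thesis
    proof eventually_elim
      case (elim x)
      show ?case
      proof (rule SUP_PInfty)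
        fix m :: nat
        obtain j where j: "\<And>k. k \<in> K j \<Longrightarrow> real m * L \<le> h j * \<epsilon> k"
          using large by blast
        obtain r where r: "\<And>g. g \<in> cube (R j) \<Longrightarrow> (\<forall>i. int (2 ^ j) dvd r $ i - g $ i) \<Longrightarrow> T g x \<in> B j"
          using elim(2) by blast
        obtain k where k: "k \<in> K j" "\<And>g i. g \<in> E k \<Longrightarrow> 2 ^ j dvd r $ i - g $ i"
          using residues[of j r] by blast
        have "h j \<le> f (T g x)" if "g \<in> E k" for g
        proof (rule f_ge)
          have "g \<in> cube (R j)"
            using block_subset[of k] that cube_mono[OF R(2)[OF k(1)]] by blast
          then show "T g x \<in> B j"
            using k(2)[OF that] by (intro r) auto
          show "F (T g x) \<noteq> \<infinity>" using elim(1) by blast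
        qed
        then have "h j * \<epsilon> k / L \<le> average T (perturbed \<inter> cube (2 * n k)) f x"
          unfolding L_def using h(1) f_nonneg e by (intro average_block_ge) auto
        moreover have "real m \<le> h j * \<epsilon> k / L"
          using j[OF k(1)] L by (simp add: pos_le_divide_eq)
        ultimately have "ereal (real m) \<le> ereal (average T (perturbed \<inter> cube (2 * n k)) f x)"
          by simp
        moreover have "perturbed \<inter> cube (2 * n k) \<noteq> {}"
          using base_pos[of k] cube_mono[of "n k" "2 * n k"] by (auto simp: card_gt_0_iff perturbed_def)
        ultimately show "\<exists>N\<in>{N. perturbed \<inter> cube N \<noteq> {}}. ereal (real m) \<le> ereal (average T (perturbed \<inter> cube N) f x)"
          by blast
      qed
    qed
  qed
  ultimately show "\<exists>f\<in>Lp q M. AE x in M. (SUP N\<in>{N. perturbed \<inter> cube N \<noteq> {}}. ereal (average T (perturbed \<inter> cube N) f x)) = \<infinity>"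
    by blast
qed simp

end

section \<open>Residue schedule, weights and heights\<close>

text \<open>
  Between \<open>2\<^bsup>jd\<^esup>\<close> and \<open>2\<^bsup>(j+1)d\<^esup>\<close> there are at least
  \<open>2\<^bsup>jd\<^esup>\<close> indices, enough to visit every residue class modulo
  \<open>2\<^sup>j\<close>.
\<close>

lemma residue_schedule:
  obtains s :: "nat \<Rightarrow> nat" and c :: "nat \<Rightarrow> int ^ 'd"
  where "\<And>k. 0 < s k"
    and "\<And>j r. \<exists>k\<in>{2 ^ (j * CARD('d))..<2 ^ (Suc j * CARD('d))}.
           s k = 2 ^ j \<and> (\<forall>i. 2 ^ j dvd r $ i - c k $ i)"
proof -
  let ?d = "CARD('d)"
  let ?I = "\<lambda>j. {2 ^ (j * ?d)..<2 ^ (Suc j * ?d)} :: nat set"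
  let ?R = "\<lambda>j. {z :: int ^ 'd. \<forall>i. z $ i \<in> {0..<2 ^ j}}"
  have "\<exists>g. ?R j \<subseteq> g ` ?I j" for j
  proof -
    have "card (?R j) = 2 ^ (j * ?d)"
      by (subst card_vec_box) (simp_all add: nat_power_eq power_mult del: atLeastLessThan_iff)
    moreover have "2 * 2 ^ (j * ?d) \<le> (2 ^ (Suc j * ?d) :: nat)"
      unfolding power_Suc[symmetric] by (intro power_increasing) auto
    ultimately have "card (?R j) \<le> card (?I j)" by simp
    then have "\<exists>f. f ` ?R j \<subseteq> ?I j \<and> inj_on f (?R j)"
      by (intro card_le_inj card_vec_box(1)) simp_all
    then obtain f where f: "f ` ?R j \<subseteq> ?I j" "inj_on f (?R j)" by blast
    have "z \<in> inv_into (?R j) f ` ?I j" if "z \<in> ?R j" for z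
      using f(1) inv_into_f_f[OF f(2) that] that by (metis (no_types, lifting) image_eqI image_subset_iff)
    then show ?thesis by blast
  qed
  then obtain g where g: "\<And>j. ?R j \<subseteq> g j ` ?I j" by metis
  \<comment> \<open>the index of the group that contains \<open>k\<close>\<close>
  define J where "J k = (LEAST j. k < 2 ^ (Suc j * ?d))" for k :: nat
  have J: "J k = j" if "k \<in> ?I j" for j k
    unfolding J_def
  proof (rule Least_equality)
    show "k < 2 ^ (Suc j * ?d)" using that by simp
    show "j \<le> l" if "k < 2 ^ (Suc l * ?d)" for l
    proof (rule ccontr)
      assume "\<not> j \<le> l"
      then have "(2 :: nat) ^ (Suc l * ?d) \<le> 2 ^ (j * ?d)"
        by (intro power_increasing mult_right_mono) auto
      also have "\<dots> \<le> k" using \<open>k \<in> ?I j\<close> by simp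
      finally show False using \<open>k < 2 ^ (Suc l * ?d)\<close> by simp
    qed
  qed
  show thesis
  proof
    show "0 < (2 :: nat) ^ J k" for k by simp
    fix j and r :: "int ^ 'd"
    have "(\<chi> i. r $ i mod 2 ^ j) \<in> ?R j" by simp
    then obtain k where k: "k \<in> ?I j" "(\<chi> i. r $ i mod 2 ^ j) = g j k"
      using g[of j] by blast
    have "2 ^ j dvd r $ i - g j k $ i" for i
      unfolding k(2)[symmetric] by (simp add: dvd_minus_mod)
    then show "\<exists>k\<in>?I j. (2 :: nat) ^ J k = 2 ^ j \<and> (\<forall>i. 2 ^ j dvd r $ i - g (J k) k $ i)"
      using k(1) J by (intro bexI[of _ k]) auto
  qed
qed

text \<open>
  The \<open>q\<close>-th power of the weight is barely not summable. The cube of the logarithm beats the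
  factor \<open>(j + 1)\<^sup>2\<close> in \<open>trap_height\<close>, since \<open>ln k\<close> is of
  order \<open>j\<close> for the indices \<open>k\<close> of modulus \<open>2\<^sup>j\<close>.
\<close>

definition block_weight :: "real \<Rightarrow> nat \<Rightarrow> real" where
  "block_weight q k = ((1 + ln (real k + 1)) ^ 3 / (real k + 1)) powr (1 / q)"

lemma block_weight_pos: "0 < block_weight q k"
proof -
  have "0 < 1 + ln (real k + 1)" by (intro add_pos_nonneg) auto
  then show ?thesis by (simp add: block_weight_def)
qed

lemma block_weight_tendsto_zero:
  assumes "0 < q"
  shows "block_weight q \<longlonglongrightarrow> 0"
  unfolding block_weight_def[abs_def] using assms by real_asymp

lemma summable_block_weight_powr:
  assumes "0 < q" "q < p"
  shows "summable (\<lambda>k. block_weight q k powr p)"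
proof -
  define r where "r = p / q"
  have r: "1 < r" using assms by (simp add: r_def)
  have eq: "block_weight q k powr p = ((1 + ln (real k + 1)) ^ 3 / (real k + 1)) powr r" for k
    by (simp add: block_weight_def powr_powr r_def)
  have "(\<lambda>k. ((1 + ln (real k + 1)) ^ 3 / (real k + 1)) powr r) \<in> O(\<lambda>k. real k powr (- (1 + r) / 2))"
    using r by real_asymp
  moreover have "summable (\<lambda>k. norm (real k powr (- (1 + r) / 2)))"
    using r by (simp add: summable_real_powr_iff)
  ultimately show ?thesis
    unfolding eq by (rule summable_comparison_test_bigo[rotated])
qed

text \<open>
  A residue trap modulo \<open>2\<^sup>j\<close> has measure of order \<open>2\<^bsup>-jd\<^esup>\<close>, so
  this height contributes an amount of order \<open>1 / (j + 1)\<^sup>2\<close> to the integral of the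
  \<open>q\<close>-th power.
\<close>

definition trap_height :: "nat \<Rightarrow> real \<Rightarrow> nat \<Rightarrow> real" where
  "trap_height d q j = (2 ^ (j * d) / (real j + 1) ^ 2) powr (1 / q)"

lemma summable_trap_height:
  assumes "0 < q"
  shows "summable (\<lambda>j. trap_height d q j powr q / (2 ^ j) ^ d)"
proof -
  have "trap_height d q j powr q / (2 ^ j) ^ d = inverse ((real (Suc j)) ^ 2)" for j
    using assms by (simp add: trap_height_def powr_powr field_simps flip: power_mult)
  moreover have "summable (\<lambda>j. inverse ((real (Suc j)) ^ 2))"
    using inverse_power_summable[of 2] by (subst summable_Suc_iff) simp
  ultimately show ?thesis by simp
qed

text \<open>
  For the indices \<open>k\<close> in question \<open>k + 1\<close> is at most
  \<open>2\<^bsup>jd\<^esup> * 2\<^sup>d\<close> and \<open>1 + ln (k + 1)\<close> is at least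
  \<open>(j + 1) / 2\<close>, so the \<open>q\<close>-th power of the product is at least
  \<open>(j + 1) / (8 * 2\<^sup>d)\<close>.
\<close>

lemma trap_height_times_weight_large:
  assumes q: "0 < q"
  shows "\<exists>j. \<forall>k\<in>{2 ^ (j * d)..<2 ^ (Suc j * d)}. C \<le> trap_height d q j * block_weight q k"
proof -
  let ?c = "max C 0"
  obtain j :: nat where j: "8 * 2 ^ d * ?c powr q \<le> real j"
    using real_arch_simple by blast
  then have d: "0 < d \<or> {2 ^ (j * d)..<2 ^ (Suc j * d)} = ({} :: nat set)" by (cases d) auto
  have "C \<le> trap_height d q j * block_weight q k" if k: "k \<in> {2 ^ (j * d)..<2 ^ (Suc j * d)}" for k
  proof -
    have "0 < d" using d k by auto
    have "real (k + 1) \<le> real (2 ^ (Suc j * d))"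
      using k unfolding of_nat_le_iff by simp
    then have up: "real k + 1 \<le> 2 ^ (j * d) * 2 ^ d"
      by (simp add: power_add mult.commute)
    have "real (2 ^ (j * d)) \<le> real k"
      using k unfolding of_nat_le_iff by simp
    then have "(2 :: real) ^ (j * d) \<le> real k + 1"
      unfolding of_nat_power of_nat_numeral by linarith
    moreover have "(2 :: real) ^ j \<le> 2 ^ (j * d)"
      using \<open>0 < d\<close> by (intro power_increasing) auto
    ultimately have "(2 :: real) ^ j \<le> real k + 1" by linarith
    then have "ln ((2 :: real) ^ j) \<le> ln (real k + 1)"
      by (subst ln_le_cancel_iff) auto
    moreover have "ln ((2 :: real) ^ j) = real j * ln 2"
      by (simp add: ln_realpow)
    moreover have "1 / 2 \<le> ln (2 :: real)"
      by (rule iffD2[OF ln_ge_iff exp_half_le2]) simp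
    then have "real j * (1 / 2) \<le> real j * ln 2"
      by (intro mult_left_mono) auto
    ultimately have "(real j + 1) / 2 \<le> 1 + ln (real k + 1)"
      by (simp add: field_simps)
    then have low: "((real j + 1) / 2) ^ 3 \<le> (1 + ln (real k + 1)) ^ 3"
      by (intro power_mono) auto
    let ?j = "real j + 1"
    have "?c powr q \<le> ?j / (8 * 2 ^ d)"
      using j by (simp add: field_simps)
    also have "\<dots> = 2 ^ (j * d) / ?j ^ 2 * ((?j / 2) ^ 3 / (2 ^ (j * d) * 2 ^ d))"
    proof -
      have cancel: "t / (8 * c) = a / t ^ 2 * ((t / 2) ^ 3 / (a * c))" if "0 < a" "0 < c" "0 < t" for a c t :: real
        using that by (simp add: field_simps power2_eq_square power3_eq_cube)
      show ?thesis
        by (rule cancel) (simp_all add: add_nonneg_pos)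
    qed
    also have "\<dots> \<le> 2 ^ (j * d) / ?j ^ 2 * ((1 + ln (real k + 1)) ^ 3 / (real k + 1))"
      using low up by (intro mult_left_mono frac_le) auto
    finally have "(?c powr q) powr (1 / q) \<le>
        (2 ^ (j * d) / ?j ^ 2 * ((1 + ln (real k + 1)) ^ 3 / (real k + 1))) powr (1 / q)"
      using q by (intro powr_mono2) auto
    also have "\<dots> = trap_height d q j * block_weight q k"
      by (simp only: trap_height_def block_weight_def powr_mult)
    finally show ?thesis
      using q by (simp add: powr_powr)
  qed
  then show ?thesis by blast
qed

section \<open>Existence of the perturbation\<close>

theorem theorem1:
  fixes D :: "(int ^ 'd) set" and q :: real
  assumes "1 \<le> q"
    and "infinite D"
    and "sparse_set D"
    and "\<And>p. q < p \<Longrightarrow> universally_pointwise_good TYPE(real) p (\<lambda>N. D \<inter> cube N)"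
  shows "\<exists>S :: (int ^ 'd) set.
           perturbation (\<lambda>N. S \<inter> cube N) (\<lambda>N. D \<inter> cube N) \<and>
           (\<forall>p>q. universally_pointwise_good TYPE(real) p (\<lambda>N. S \<inter> cube N)) \<and>
           universally_sweeping_out TYPE(real) q (\<lambda>N. S \<inter> cube N)"
proof -
  let ?d = "CARD('d)"
  let ?K = "\<lambda>j. {2 ^ (j * ?d)..<2 ^ (Suc j * ?d)} :: nat set"
  have q: "0 < q" using assms(1) by simp
  obtain s :: "nat \<Rightarrow> nat" and c :: "nat \<Rightarrow> int ^ 'd" where s: "\<And>k. 0 < s k"
    and schedule: "\<And>j r. \<exists>k\<in>?K j. s k = 2 ^ j \<and> (\<forall>i. 2 ^ j dvd r $ i - c k $ i)"
    using residue_schedule by blast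
  have "\<exists>n E. sparse_blocks D (block_weight q) n E \<and> (\<forall>k. \<forall>g\<in>E k. \<forall>i. int (s k) dvd g $ i - c k $ i)"
    using assms(2,3) block_weight_pos block_weight_tendsto_zero[OF q] s by (rule sparse_blocks_exist)
  then obtain n E where blocks: "sparse_blocks D (block_weight q) n E"
    and class_of_block: "\<And>k g i. g \<in> E k \<Longrightarrow> int (s k) dvd g $ i - c k $ i"
    by blast
  interpret sparse_blocks D "block_weight q" n E by (rule blocks)
  have residues: "\<exists>k\<in>?K j. \<forall>g\<in>E k. \<forall>i. 2 ^ j dvd r $ i - g $ i" for j and r :: "int ^ 'd"
  proof -
    obtain k where k: "k \<in> ?K j" "s k = 2 ^ j" "\<And>i. 2 ^ j dvd r $ i - c k $ i"
      using schedule by blast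
    have "2 ^ j dvd r $ i - g $ i" if "g \<in> E k" for g i
    proof -
      have "2 ^ j dvd g $ i - c k $ i"
        using class_of_block[OF that, of i] k(2) by simp
      with k(3)[of i] have "2 ^ j dvd (r $ i - c k $ i) - (g $ i - c k $ i)"
        by (rule dvd_diff)
      then show ?thesis by simp
    qed
    then show ?thesis using k(1) by blast
  qed
  show ?thesis
  proof (intro exI[of _ perturbed] conjI allI impI)
    show "perturbation (\<lambda>N. perturbed \<inter> cube N) (\<lambda>N. D \<inter> cube N)"
      by (rule perturbation_perturbed)
    show "universally_pointwise_good TYPE(real) p (\<lambda>N. perturbed \<inter> cube N)" if "q < p" for p
      using assms(1) that q assms(4)
      by (intro universally_pointwise_good_perturbed summable_block_weight_powr) auto
    show "universally_sweeping_out TYPE(real) q (\<lambda>N. perturbed \<inter> cube N)"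
    proof (rule universally_sweeping_out_perturbed[where K = ?K and h = "trap_height ?d q"])
      show "0 < q" by (rule q)
      show "finite (?K j)" for j by simp
      show "\<exists>k\<in>?K j. \<forall>g\<in>E k. \<forall>i. 2 ^ j dvd r $ i - g $ i" for j r by (rule residues)
      show "0 \<le> trap_height ?d q j" for j by (simp add: trap_height_def)
      show "summable (\<lambda>j. trap_height ?d q j powr q / (2 ^ j) ^ ?d)"
        using q by (rule summable_trap_height)
      show "\<exists>j. \<forall>k\<in>?K j. C \<le> trap_height ?d q j * block_weight q k" for C
        using q by (rule trap_height_times_weight_large)
    qed
  qed
qed

end
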